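(* Let $p_a^\alpha(x)$ be the ($n$th) associated graded sequence of the delta operator $f(D)$. Then for every $\alpha$ the following identity of formal series in $y$ holds. Discrete: $$\sum_{k}\frac{p_k^\alpha(x)}{\lfloor k\rceil!}\,y^k=[\exp]_\alpha\big(x f^{(-1)}(y)\big):=\sum_{k}\frac{\lambda_k^\alpha(x)}{\lfloor k\rceil!}\big(f^{(-1)}(y)\big)^k,$$ the sums running over all integers $k$. Continuous: $$\sum_{a}\frac{p_a^\alpha(x)}{\lfloor a\rceil!}\,y^a=[\exp]_\alpha^{\,xf^{(-1)}(y);n}:=\sum_{a}\frac{\lambda_a^\alpha(x)}{\lfloor a\rceil!}\big(f^{(-1)}(y)\big)^{a;n},$$ the sums running over all real $a$, where $(\cdot)^{a;n}$ is the $n$th determination of the $a$th power. (The right-hand sides are expanded in powers of $y$ and the coefficients, which lie in $\mathcal I^\alpha$, are collected.)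
   Context: Two interpretations. Discrete: indices $a,b,\dots$ are integers and $\alpha,\beta$ are finitely supported vectors $(\alpha_1,\alpha_2,\dots)$ of integers. Continuous: the indices are real numbers and $\alpha,\beta$ are finitely supported real vectors. $(0)$ is the zero vector. Coefficients are complex. Roman factorials: $\lfloor a\rceil!=\Gamma(a+1)$ if $a$ is not a negative integer, and $\lfloor a\rceil!=(-1)^{a+1}/(-a-1)!$ if $a$ is a negative integer. Logarithmic algebra: put $\ell^{(a),\alpha}=x^a(\log x)^{\alpha_1}(\log\log x)^{\alpha_2}\cdots$. $\mathcal I$ is the algebra of formal series in these monomials, ordered lexicographically (exponent of $x$ first), with reverse well-ordered support; $D=d/dx$ acts termwise. Harmonic logarithms: with $\delta=xD$ and the Taylor expansion $\Gamma(s+1)/\Gamma(s+a+1)=\sum_{k\ge0}c_k(a)s^k$ at $s=0$, put $\lambda_a^\alpha(x)=\lfloor a\rceil!\,x^a\sum_{k\ge0}c_k(a)\,\delta^k\ell^{(0),\alpha}$. Thus $\lambda_0^\alpha=\ell^{(0),\alpha}$; $\lambda_a^{(0)}=x^a$ if $a$ is not a negative integer and $\lambda_a^{(0)}=0$ if it is. $\mathcal I^\alpha$ is the space of series $\sum_a c_a\lambda_a^\alpha$ whose set of exponents $a$ with $c_a\ne0$ is reverse well-ordered (in the discrete case: integers bounded above); its degree is the largest such $a$. $\langle p\rangle_\alpha$ is the coefficient of $\lambda_0^\alpha$ in $p\in\mathcal I^\alpha$. Operators: for $\alpha\neq(0)$, $D^b\lambda_a^\alpha=\frac{\lfloor a\rceil!}{\lfloor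 a-b\rceil!}\lambda_{a-b}^\alpha$ for every index $b$. An Artinian operator is $g(D)=\sum_b g_bD^b$ with well-ordered support (in the discrete case, a Laurent series in $D$); its degree is the least $b$ with $g_b\ne0$. A delta operator is an Artinian operator of degree $1$. Determinations of powers: let $n$ be an integer and let $f(D)=cD(1+h(D))$ be a series of degree $1$, with $c\neq0$ and $h$ having only positive exponents. Then $f(D)^{b;n}=|c|^be^{ib(\arg c+2\pi n)}D^b\sum_{k\ge0}\binom bk h(D)^k$ with $-\pi<\arg c\le\pi$ (independent of $n$ for integer $b$). The same definition is used for series in $y$ of degree $1$, with $y$ in place of $D$. Compositional inverse: in the discrete case $f^{(-1)}(y)$ is the usual compositional inverse of $f$, and its powers are the usual ones. In the continuous case $f^{(-1)}(y)$ is the compositional inverse of $f$ taken with respect to the $n$th determination, that is, the series in $y$ with well-ordered support that becomes $D$ when every $y^a$ is replaced by $f(D)^{a;n}$. Graded sequence: a family $p_a^\alpha(x)\in\mathcal I^\alpha$ such that for $\alpha\ne(0)$ the degree of $p_a^\alpha$ is $a$, and which is regular: for every $\alpha\neq(0)$ and every $\beta$, replacing each $\lambda_b^\alpha$ by $\lambda_b^\beta$ in $p_a^\alpha$ gives $p_a^\beta$. The ($n$th) associated sequence of a delta operator $f(D)$ is the graded sequence with $\langle f(D)^{b;n}p_a^\alpha\rangle_\alpha=\lfloor a\rceil!\,\delta_{ab}$ for all $a,b$ and $\alpha\neq(0)$.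
   Formalization: In the continuous case the powers of f^{(-1)}(y) use determination -n (or -n-1 if the leading coefficient c of f is a negative real) instead of n; with n the identity fails, e.g. for f(D)=D, n=1, and it agrees with the original exactly when n=0 and c is not a negative real. *)

theory Defs
  imports
    "HOL-Complex_Analysis.Complex_Analysis"
    "HOL-Library.Poly_Mapping"
begin

text \<open>
  The two interpretations are treated together: \<open>J\<close> is the set of admissible indices, \<open>\<int>\<close>
  (discrete) or \<open>UNIV\<close> (continuous), both as sets of reals. All locally finite sums are
  written with \<^const>\<open>Sum_any\<close>, the sum over the (finite) set of nonzero summands.
\<close>

definition roman_factorial :: "real \<Rightarrow> real" where
  "roman_factorial a =
     (if a \<in> \<int> \<and> a < 0 then (-1) powi (\<lfloor>a\<rfloor> + 1) / fact (nat (- \<lfloor>a\<rfloor> - 1)) else Gamma (a + 1))"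

subsection \<open>The logarithmic algebra\<close>

text \<open>
  A vector \<open>(\<alpha>\<^sub>1, \<alpha>\<^sub>2, \<dots>)\<close> is indexed from \<open>0\<close>: \<open>lookup \<alpha> j\<close> is \<open>\<alpha>\<close> at position \<open>j + 1\<close>, the exponent
  of the \<open>(j + 1)\<close>-fold iterated logarithm. The pair \<open>(a, \<alpha>)\<close> stands for the monomial
  \<open>x\<^sup>a (log x)\<^bsup>\<alpha>\<^sub>1\<^esup> (log log x)\<^bsup>\<alpha>\<^sub>2\<^esup> \<dots>\<close>. The order of \<^typ>\<open>nat \<Rightarrow>\<^sub>0 real\<close> is the lexicographic one.
\<close>

type_synonym log_monomial = "real \<times> (nat \<Rightarrow>\<^sub>0 real)"
type_synonym log_series = "log_monomial \<Rightarrow> complex"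

definition index_vectors :: "real set \<Rightarrow> (nat \<Rightarrow>\<^sub>0 real) set" where
  "index_vectors J = {\<alpha>. range (Poly_Mapping.lookup \<alpha>) \<subseteq> J}"

definition monomial_less :: "log_monomial \<Rightarrow> log_monomial \<Rightarrow> bool" where
  "monomial_less m m' \<longleftrightarrow> fst m < fst m' \<or> fst m = fst m' \<and> snd m < snd m'"

definition log_algebra :: "real set \<Rightarrow> log_series set" where
  "log_algebra J =
     {s. {m. s m \<noteq> 0} \<subseteq> J \<times> index_vectors J \<and> wfp_on {m. s m \<noteq> 0} (\<lambda>m m'. monomial_less m' m)}"

definition log_monom :: "log_monomial \<Rightarrow> log_series" where
  "log_monom m = (\<lambda>m'. of_bool (m' = m))"

text \<open>
  The derivative of the \<open>(j + 1)\<close>-fold iterated logarithm is the reciprocal of the product of \<open>x\<close>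
  and its first \<open>j\<close> iterated logarithms.
\<close>

definition deriv_monom :: "log_monomial \<Rightarrow> log_series" where
  "deriv_monom = (\<lambda>(a, \<alpha>) m.
     of_real a * log_monom (a - 1, \<alpha>) m +
     (\<Sum>j\<in>Poly_Mapping.keys \<alpha>. of_real (Poly_Mapping.lookup \<alpha> j) *
        log_monom (a - 1, \<alpha> - (\<Sum>i\<le>j. Poly_Mapping.single i 1)) m))"

definition log_deriv :: "log_series \<Rightarrow> log_series" where
  "log_deriv s = (\<lambda>m. Sum_any (\<lambda>m'. s m' * deriv_monom m' m))"

definition x_times :: "real \<Rightarrow> log_series \<Rightarrow> log_series" where
  "x_times a s = (\<lambda>(b, \<beta>). s (b - a, \<beta>))"

definition xD :: "log_series \<Rightarrow> log_series" where
  "xD s = x_times 1 (log_deriv s)"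

subsection \<open>Harmonic logarithms\<close>

text \<open>
  As \<open>Gamma\<close> is \<open>0\<close> at its poles and division by \<open>0\<close> gives \<open>0\<close>, the quotient below is the
  analytic function \<open>\<Gamma>(s + 1) / \<Gamma>(s + a + 1)\<close> around \<open>s = 0\<close>, also for negative integers \<open>a\<close>.
\<close>

definition harmonic_coeffs :: "real \<Rightarrow> complex fps" where
  "harmonic_coeffs a = fps_expansion (\<lambda>s. Gamma (s + 1) / Gamma (s + of_real a + 1)) 0"

definition harmonic_log :: "real \<Rightarrow> (nat \<Rightarrow>\<^sub>0 real) \<Rightarrow> log_series" where
  "harmonic_log a \<alpha> = (\<lambda>m. of_real (roman_factorial a) *
     x_times a (\<lambda>m'. Sum_any (\<lambda>k. fps_nth (harmonic_coeffs a) k * (xD ^^ k) (log_monom (0, \<alpha>)) m')) m)"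

definition harmonic_families :: "real set \<Rightarrow> (real \<Rightarrow> complex) set" where
  "harmonic_families J = {c. {a. c a \<noteq> 0} \<subseteq> J \<and> wfp_on {a. c a \<noteq> 0} (>)}"

definition harmonic_sum :: "(nat \<Rightarrow>\<^sub>0 real) \<Rightarrow> (real \<Rightarrow> complex) \<Rightarrow> log_series" where
  "harmonic_sum \<alpha> c = (\<lambda>m. Sum_any (\<lambda>a. c a * harmonic_log a \<alpha> m))"

definition harmonic_space :: "real set \<Rightarrow> (nat \<Rightarrow>\<^sub>0 real) \<Rightarrow> log_series set" where
  "harmonic_space J \<alpha> = {p \<in> log_algebra J. \<exists>c \<in> harmonic_families J. p = harmonic_sum \<alpha> c}"

text \<open>
  For \<open>\<alpha> \<noteq> 0\<close> the family of coefficients is unique. For \<open>\<alpha> = 0\<close> it is unique only up to the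
  coefficients at the negative integers, where the harmonic logarithm is \<open>0\<close>.
\<close>

definition harmonic_coeff :: "real set \<Rightarrow> (nat \<Rightarrow>\<^sub>0 real) \<Rightarrow> log_series \<Rightarrow> real \<Rightarrow> complex" where
  "harmonic_coeff J \<alpha> p = (SOME c. c \<in> harmonic_families J \<and> p = harmonic_sum \<alpha> c)"

definition has_log_degree :: "real set \<Rightarrow> (nat \<Rightarrow>\<^sub>0 real) \<Rightarrow> log_series \<Rightarrow> real \<Rightarrow> bool" where
  "has_log_degree J \<alpha> p a \<longleftrightarrow>
     harmonic_coeff J \<alpha> p a \<noteq> 0 \<and> (\<forall>b. harmonic_coeff J \<alpha> p b \<noteq> 0 \<longrightarrow> b \<le> a)"

definition bracket :: "real set \<Rightarrow> (nat \<Rightarrow>\<^sub>0 real) \<Rightarrow> log_series \<Rightarrow> complex" where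
  "bracket J \<alpha> p = harmonic_coeff J \<alpha> p 0"

subsection \<open>Artinian series and determinations of powers\<close>

text \<open>
  A series in \<open>D\<close> or in \<open>y\<close> is given by its coefficient function.
\<close>

type_synonym art_series = "real \<Rightarrow> complex"

definition artinian :: "real set \<Rightarrow> art_series \<Rightarrow> bool" where
  "artinian J g \<longleftrightarrow> {b. g b \<noteq> 0} \<subseteq> J \<and> wfp_on {b. g b \<noteq> 0} (<)"

definition has_art_degree :: "art_series \<Rightarrow> real \<Rightarrow> bool" where
  "has_art_degree g d \<longleftrightarrow> g d \<noteq> 0 \<and> (\<forall>b. g b \<noteq> 0 \<longrightarrow> d \<le> b)"

definition delta_operator :: "real set \<Rightarrow> art_series \<Rightarrow> bool" where
  "delta_operator J f \<longleftrightarrow> artinian J f \<and> has_art_degree f 1"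

definition art_one :: art_series where
  "art_one = (\<lambda>b. of_bool (b = 0))"

definition art_mult :: "art_series \<Rightarrow> art_series \<Rightarrow> art_series" where
  "art_mult g h = (\<lambda>b. Sum_any (\<lambda>a. g a * h (b - a)))"

text \<open>The series \<open>h\<close> in \<open>f(D) = c D (1 + h(D))\<close>, where \<open>c = f 1\<close>.\<close>

definition unit_tail :: "art_series \<Rightarrow> art_series" where
  "unit_tail f = (\<lambda>b. f (b + 1) / f 1 - art_one b)"

text \<open>\<open>det_power n f b e\<close> is the coefficient of \<open>D\<^sup>e\<close> in \<open>f(D)\<^bsup>b;n\<^esup>\<close>.\<close>

definition det_power :: "int \<Rightarrow> art_series \<Rightarrow> real \<Rightarrow> art_series" where
  "det_power n f b = (\<lambda>e.
     of_real (norm (f 1) powr b) * exp (\<i> * of_real (b * (Arg (f 1) + 2 * pi * of_int n))) *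
     Sum_any (\<lambda>k. (of_real b gchoose k) * (art_mult (unit_tail f) ^^ k) art_one (e - b)))"

text \<open>The action on \<open>harmonic_space J \<alpha>\<close> for \<open>\<alpha> \<noteq> 0\<close>.\<close>

definition apply_operator ::
  "real set \<Rightarrow> (nat \<Rightarrow>\<^sub>0 real) \<Rightarrow> art_series \<Rightarrow> log_series \<Rightarrow> log_series" where
  "apply_operator J \<alpha> g p = (\<lambda>m. Sum_any (\<lambda>(a, b).
     harmonic_coeff J \<alpha> p a * g b * of_real (roman_factorial a / roman_factorial (a - b)) *
     harmonic_log (a - b) \<alpha> m))"

subsection \<open>Graded and associated sequences\<close>

definition regular_family ::
  "real set \<Rightarrow> (real \<Rightarrow> (nat \<Rightarrow>\<^sub>0 real) \<Rightarrow> log_series) \<Rightarrow> bool" where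
  "regular_family J p \<longleftrightarrow> (\<forall>a\<in>J. \<forall>\<alpha>\<in>index_vectors J - {0}. \<forall>\<beta>\<in>index_vectors J.
     harmonic_sum \<beta> (harmonic_coeff J \<alpha> (p a \<alpha>)) = p a \<beta>)"

definition graded_sequence ::
  "real set \<Rightarrow> (real \<Rightarrow> (nat \<Rightarrow>\<^sub>0 real) \<Rightarrow> log_series) \<Rightarrow> bool" where
  "graded_sequence J p \<longleftrightarrow>
     (\<forall>a\<in>J. \<forall>\<alpha>\<in>index_vectors J. p a \<alpha> \<in> harmonic_space J \<alpha>) \<and>
     (\<forall>a\<in>J. \<forall>\<alpha>\<in>index_vectors J - {0}. has_log_degree J \<alpha> (p a \<alpha>) a) \<and>
     regular_family J p"

definition associated_sequence ::
  "real set \<Rightarrow> int \<Rightarrow> art_series \<Rightarrow> (real \<Rightarrow> (nat \<Rightarrow>\<^sub>0 real) \<Rightarrow> log_series) \<Rightarrow> bool" where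
  "associated_sequence J n f p \<longleftrightarrow> graded_sequence J p \<and>
     (\<forall>a\<in>J. \<forall>b\<in>J. \<forall>\<alpha>\<in>index_vectors J - {0}.
        bracket J \<alpha> (apply_operator J \<alpha> (det_power n f b) (p a \<alpha>)) =
        (if a = b then of_real (roman_factorial a) else 0))"

subsection \<open>Compositional inverses and logarithmic exponentials\<close>

text \<open>Replacing every \<open>y\<^sup>a\<close> in \<open>g(y)\<close> by \<open>f(D)\<^bsup>a;n\<^esup>\<close>.\<close>

definition det_subst :: "int \<Rightarrow> art_series \<Rightarrow> art_series \<Rightarrow> art_series" where
  "det_subst n f g = (\<lambda>e. Sum_any (\<lambda>a. g a * det_power n f a e))"

definition det_inverse :: "int \<Rightarrow> art_series \<Rightarrow> art_series" where
  "det_inverse n f = (THE g. artinian UNIV g \<and> det_subst n f g = (\<lambda>e. of_bool (e = 1)))"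

text \<open>
  Powers of the inverse series. The series \<open>f\<^bsup>(-1)\<^esup>\<close> has leading coefficient \<open>1/c\<close>. If the powers of
  \<open>f\<close> are formed with the argument \<open>arg c + 2\<pi>n\<close> of \<open>c\<close>, the powers of \<open>f\<^bsup>(-1)\<^esup>\<close> inverse to them under
  composition are formed with the argument \<open>-(arg c + 2\<pi>n)\<close> of \<open>1/c\<close>. In the numbering of
  \<^const>\<open>det_power\<close>, relative to the principal argument of \<open>1/c\<close>, this determination has the
  number \<open>-n\<close>, or \<open>-n - 1\<close> if \<open>c\<close> is a negative real, since then \<open>1/c\<close> has principal argument \<open>\<pi>\<close>,
  not \<open>-\<pi>\<close>. The numbers agree if \<open>n = 0\<close> and \<open>c\<close> is not a negative real; otherwise the
  determination numbered \<open>n\<close> is not the inverse one: for \<open>f(D) = D\<close> the associated sequence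
  is \<open>e\<^bsup>-2\<pi>ian\<^esup> \<lambda>\<^sub>a\<close>, and \<open>f\<^bsup>(-1)\<^esup>(y) = y\<close> must be raised to powers as \<open>e\<^bsup>-2\<pi>ian\<^esup> y\<^sup>a\<close>.
\<close>

definition inverse_determination :: "int \<Rightarrow> art_series \<Rightarrow> int" where
  "inverse_determination n f = (if f 1 \<in> \<real>\<^sub>\<le>\<^sub>0 then - n - 1 else - n)"

lemma Arg_inverse_determination:
  assumes "f 1 \<noteq> 0"
  shows "Arg (inverse (f 1)) + 2 * pi * of_int (inverse_determination n f) =
         - (Arg (f 1) + 2 * pi * of_int n)"
proof (cases "f 1 \<in> \<real>\<^sub>\<le>\<^sub>0")
  case True
  then have r: "f 1 \<in> \<real>" "Re (f 1) < 0"
    using assms by (auto simp: complex_nonpos_Reals_iff complex_is_Real_iff complex_eq_iff)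
  then have "Arg (f 1) = pi"
    by (simp add: Arg_eq_pi_iff)
  with True r show ?thesis
    by (simp add: inverse_determination_def Arg_inverse algebra_simps)
next
  case False
  then have "Arg (f 1) = 0" if "f 1 \<in> \<real>"
    using that by (auto simp: Arg_real complex_nonpos_Reals_iff complex_is_Real_iff)
  with False show ?thesis
    by (auto simp: inverse_determination_def Arg_inverse algebra_simps)
qed

text \<open>
  The coefficient of \<open>y\<^sup>j\<close> in the expansion of \<open>[exp]\<^sub>\<alpha>(x g(y))\<close> and of the continuous
  logarithmic exponential formed with the powers \<open>g(y)\<^bsup>a;n\<^esup>\<close>.
\<close>

definition log_exp :: "(nat \<Rightarrow>\<^sub>0 real) \<Rightarrow> complex fls \<Rightarrow> int \<Rightarrow> log_series" where
  "log_exp \<alpha> g j = (\<lambda>m. Sum_any (\<lambda>k::int.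
     harmonic_log (of_int k) \<alpha> m / of_real (roman_factorial (of_int k)) * fls_nth (g powi k) j))"

definition log_exp_det :: "int \<Rightarrow> (nat \<Rightarrow>\<^sub>0 real) \<Rightarrow> art_series \<Rightarrow> real \<Rightarrow> log_series" where
  "log_exp_det n \<alpha> g b = (\<lambda>m. Sum_any (\<lambda>a::real.
     harmonic_log a \<alpha> m / of_real (roman_factorial a) * det_power n g a b))"

end

theory Submission
  imports Defs "HOL-Library.Set_Algebras"
begin

text \<open>
  All harmonic logarithms \<open>\<lambda>\<^sub>a\<^sup>\<alpha>\<close> are supported at the exponent \<open>a\<close> of \<open>x\<close>, so series in them may be
  compared coefficientwise, and by regularity one vector \<open>\<alpha> \<noteq> 0\<close> suffices. Let \<open>P\<^sub>b\<^sub>c\<close> be the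
  coefficient of \<open>D\<^sup>c\<close> in \<open>f(D)\<^bsup>b;n\<^esup>\<close>. If \<open>p\<^sub>a\<close> has the coefficients \<open>\<lfloor>a\<rceil>! r\<^sub>c / \<lfloor>c\<rceil>!\<close>, then
  being associated to \<open>f\<close> says \<open>\<Sum>\<^sub>c P\<^sub>b\<^sub>c r\<^sub>c = \<delta>\<^sub>a\<^sub>b\<close>, so \<open>r\<close> is a column of the matrix inverse of \<open>P\<close>. Now
  \<open>g \<mapsto> \<Sum>\<^sub>b g\<^sub>b f(D)\<^bsup>b;n\<^esup>\<close> is a bijective ring homomorphism on series with well-ordered support that
  commutes with binomial series. It sends \<open>f\<^bsup>(-1)\<^esup>(y)\<close> to \<open>D\<close>, hence the \<open>c\<close>th power of \<open>f\<^bsup>(-1)\<^esup>(y)\<close> to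
  \<open>D\<^sup>c\<close>. So the coefficients of these powers are the rows of the inverse of \<open>P\<close>. Identities between
  binomial series are polynomial in the exponent in each coefficient, and so reduce to natural
  exponents.
\<close>

section \<open>Well-ordered sets of reals\<close>

abbreviation well_ordered :: "real set \<Rightarrow> bool" where
  "well_ordered A \<equiv> wfp_on A (<)"

lemma well_ordered_iff: "well_ordered A \<longleftrightarrow> (\<forall>B\<subseteq>A. B \<noteq> {} \<longrightarrow> (\<exists>z\<in>B. \<forall>y\<in>B. z \<le> y))"
  unfolding wfp_on_iff_ex_minimal by (meson linorder_not_less)

lemma rev_well_ordered_iff: "wfp_on A (>) \<longleftrightarrow> well_ordered (uminus ` A)"
  by (simp add: wfp_on_image)

text \<open>An infinite subset has infinitely many elements above its least one. So if A were
  infinite, the set \<open>?T\<close> of points with infinitely many elements above them would be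
  nonempty and have a greatest element \<open>t\<close>; but the least element above
  \<open>t\<close> again lies in \<open>?T\<close>.\<close>

lemma finite_if_wfp_on_both:
  fixes A :: "'a::linorder set"
  assumes "wfp_on A (<)" "wfp_on A (>)"
  shows "finite A"
proof (rule ccontr)
  assume inf: "infinite A"
  have lo: "\<exists>z\<in>B. \<forall>y\<in>B. z \<le> y" if "B \<subseteq> A" "B \<noteq> {}" for B
    using assms(1) that unfolding wfp_on_iff_ex_minimal by (meson linorder_not_less)
  have hi: "\<exists>z\<in>B. \<forall>y\<in>B. y \<le> z" if "B \<subseteq> A" "B \<noteq> {}" for B
    using assms(2) that unfolding wfp_on_iff_ex_minimal by (meson linorder_not_less)
  let ?T = "{a\<in>A. infinite {x\<in>A. a < x}}"
  have step: "\<exists>m\<in>B. infinite {x\<in>B. m < x}" if B: "B \<subseteq> A" "infinite B" for B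
  proof -
    from B(2) have "B \<noteq> {}"
      by auto
    obtain m where m: "m \<in> B" "\<forall>y\<in>B. m \<le> y"
      using lo[OF B(1) \<open>B \<noteq> {}\<close>] by blast
    then have "{x\<in>B. m < x} = B - {m}"
      by force
    with m B show ?thesis
      by (metis infinite_remove)
  qed
  from step[of A] inf have "?T \<noteq> {}"
    by auto
  then obtain t where t: "t \<in> ?T" "\<forall>y\<in>?T. y \<le> t"
    using hi[of ?T] by blast
  obtain m where m: "m \<in> A" "t < m" "infinite {x\<in>{x\<in>A. t < x}. m < x}"
    using step[of "{x\<in>A. t < x}"] t by auto
  then have "{x\<in>{x\<in>A. t < x}. m < x} = {x\<in>A. m < x}"
    by auto
  with m t show False
    by fastforce
qed

text \<open>The map a \<mapsto> e - a reverses the order, so the fibre is well-ordered in both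
  directions. This makes every coefficient of a convolution a finite sum.\<close>

lemma finite_fibre:
  assumes "well_ordered A" "well_ordered B"
  shows "finite {a\<in>A. e - a \<in> B}"
proof (rule finite_if_wfp_on_both)
  show "wfp_on {a\<in>A. e - a \<in> B} (<)"
    using assms(1) by (rule wfp_on_subset) auto
  have "wfp_on ((\<lambda>a. e - a) ` {a\<in>A. e - a \<in> B}) (<)"
    using assms(2) by (rule wfp_on_subset) auto
  then show "wfp_on {a\<in>A. e - a \<in> B} (>)"
    by (simp add: wfp_on_image)
qed

text \<open>
  Over each \<open>a\<close> keep the least admissible \<open>\<beta> a\<close>. Where \<open>\<beta>\<close> reaches a new strict minimum it is
  strictly decreasing, so these places form a set that is well-ordered in both directions.
\<close>

lemma well_ordered_sumset:
  assumes A: "well_ordered A" and B: "well_ordered B"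
  shows "well_ordered (A + B)"
  unfolding well_ordered_iff
proof (intro allI impI)
  fix S assume S: "S \<subseteq> A + B" "S \<noteq> {}"
  define X where "X = {a\<in>A. \<exists>b\<in>B. a + b \<in> S}"
  have "\<exists>b. b \<in> B \<and> a + b \<in> S \<and> (\<forall>b'\<in>B. a + b' \<in> S \<longrightarrow> b \<le> b')" if "a \<in> X" for a
  proof -
    have "{b\<in>B. a + b \<in> S} \<subseteq> B" "{b\<in>B. a + b \<in> S} \<noteq> {}"
      using that by (auto simp: X_def)
    then have "\<exists>z\<in>{b\<in>B. a + b \<in> S}. \<forall>y\<in>{b\<in>B. a + b \<in> S}. z \<le> y"
      using B[unfolded well_ordered_iff] by blast
    then show ?thesis
      by blast
  qed
  then obtain \<beta> where \<beta>: "\<And>a. a \<in> X \<Longrightarrow> \<beta> a \<in> B \<and> a + \<beta> a \<in> S \<and> (\<forall>b'\<in>B. a + b' \<in> S \<longrightarrow> \<beta> a \<le> b')"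
    by metis
  define R where "R = {a\<in>X. \<forall>a'\<in>X. a' < a \<longrightarrow> \<beta> a < \<beta> a'}"
  have XA: "X \<subseteq> A" and RX: "R \<subseteq> X"
    by (auto simp: X_def R_def)
  have wX: "wfp_on X (<)"
    using A XA by (rule wfp_on_subset)
  \<comment> \<open>A point outside \<open>R\<close> has an earlier point where \<beta> is no
    larger, so the sum there is smaller; well-founded descent ends in \<open>R\<close>. Hence a
    least sum over the finite set \<open>R\<close> is least in \<open>S\<close>.\<close>
  have below: "\<exists>r\<in>R. r + \<beta> r \<le> a + \<beta> a" if "a \<in> X" for a
    using wX that
  proof (induction a rule: wfp_on_induct)
    case (less a)
    show ?case
    proof (cases "a \<in> R")
      case False
      then obtain a' where a': "a' \<in> X" "a' < a" "\<beta> a' \<le> \<beta> a"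
        using less by (force simp: R_def)
      then obtain r where "r \<in> R" "r + \<beta> r \<le> a' + \<beta> a'"
        using less by blast
      with a' show ?thesis
        by (intro bexI[of _ r]) auto
    qed auto
  qed (use that in auto)
  have "finite R"
  proof (rule finite_if_wfp_on_both)
    show "wfp_on R (<)"
      using wX RX by (rule wfp_on_subset)
    have "wfp_on (\<beta> ` R) (<)"
      using B by (rule wfp_on_subset) (use \<beta> RX in auto)
    then have "wfp_on R (\<lambda>a b. \<beta> a < \<beta> b)"
      by (simp add: wfp_on_image)
    then show "wfp_on R (>)"
      by (rule wfp_on_mono_strong) (auto simp: R_def)
  qed
  moreover have "X \<noteq> {}"
    using S by (fastforce simp: X_def set_plus_def)
  with below have "R \<noteq> {}"
    by blast
  ultimately obtain r where r: "r \<in> R" "\<And>r'. r' \<in> R \<Longrightarrow> r + \<beta> r \<le> r' + \<beta> r'"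
    by (meson arg_min_if_finite(1) arg_min_least)
  show "\<exists>z\<in>S. \<forall>y\<in>S. z \<le> y"
  proof (intro bexI ballI)
    show "r + \<beta> r \<in> S"
      using r(1) RX \<beta> by auto
    fix y assume "y \<in> S"
    then obtain a b where ab: "a \<in> A" "b \<in> B" "y = a + b"
      using S(1) by (meson set_plus_elim subsetD)
    with \<open>y \<in> S\<close> have "a \<in> X"
      by (auto simp: X_def)
    with \<beta>[OF this] ab \<open>y \<in> S\<close> have "a + \<beta> a \<le> y"
      by auto
    moreover obtain r' where "r' \<in> R" "r' + \<beta> r' \<le> a + \<beta> a"
      using below \<open>a \<in> X\<close> by blast
    ultimately show "r + \<beta> r \<le> y"
      using r(2)[of r'] by linarith
  qed
qed

lemma well_ordered_Un:
  assumes "well_ordered A" "well_ordered B"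
  shows "well_ordered (A \<union> B)"
  unfolding well_ordered_iff
proof (intro allI impI)
  fix S assume S: "S \<subseteq> A \<union> B" "S \<noteq> {}"
  consider "S \<inter> A = {}" | "S \<inter> B = {}" | "S \<inter> A \<noteq> {}" "S \<inter> B \<noteq> {}"
    by blast
  then show "\<exists>z\<in>S. \<forall>y\<in>S. z \<le> y"
  proof cases
    case 1
    with S have "S \<subseteq> B" by auto
    with S assms show ?thesis by (auto simp: well_ordered_iff)
  next
    case 2
    with S have "S \<subseteq> A" by auto
    with S assms show ?thesis by (auto simp: well_ordered_iff)
  next
    case 3
    obtain x where x: "x \<in> S \<inter> A" "\<forall>y\<in>S \<inter> A. x \<le> y"
      using assms(1)[unfolded well_ordered_iff, rule_format, of "S \<inter> A"] 3 by blast
    obtain x' where x': "x' \<in> S \<inter> B" "\<forall>y\<in>S \<inter> B. x' \<le> y"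
      using assms(2)[unfolded well_ordered_iff, rule_format, of "S \<inter> B"] 3 by blast
    have "min x x' \<in> S"
      using x x' by (auto simp: min_def)
    moreover have "min x x' \<le> y" if "y \<in> S" for y
      using x(2) x'(2) that S(1) by (force simp: min_le_iff_disj)
    ultimately show ?thesis
      by blast
  qed
qed

lemma well_ordered_finite: "finite A \<Longrightarrow> well_ordered A"
  unfolding well_ordered_iff by (metis finite_subset Min_in Min_le)

section \<open>Iterated sumsets and additive closures of sets of positive reals\<close>

definition multisums :: "real set \<Rightarrow> nat \<Rightarrow> real set" where
  "multisums A k = ((+) A ^^ k) {0}"

lemma multisums_0 [simp]: "multisums A 0 = {0}"
  and multisums_Suc: "multisums A (Suc k) = A + multisums A k"
  by (simp_all add: multisums_def)

lemma well_ordered_multisums: "well_ordered A \<Longrightarrow> well_ordered (multisums A k)"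
  by (induction k) (auto simp: multisums_Suc well_ordered_sumset well_ordered_finite)

lemma multisums_add:
  assumes "x \<in> multisums A k" "y \<in> multisums A l"
  shows "x + y \<in> multisums A (k + l)"
  using assms
proof (induction k arbitrary: x)
  case (Suc k)
  then obtain a b where ab: "a \<in> A" "b \<in> multisums A k" "x = a + b"
    by (auto simp: multisums_Suc set_plus_def)
  with Suc show ?case
    by (simp add: multisums_Suc set_plus_def add.assoc) blast
qed simp

lemma multisums_lower_bound:
  assumes "\<And>a. a \<in> A \<Longrightarrow> d \<le> a" "x \<in> multisums A k"
  shows "real k * d \<le> x"
  using assms(2)
  by (induction k arbitrary: x)
     (auto simp: multisums_Suc set_plus_def algebra_simps intro!: add_mono assms(1))

lemma well_ordered_positive_bound:
  assumes "well_ordered A" "A \<subseteq> {0<..}"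
  obtains d where "d > 0" "\<And>a. a \<in> A \<Longrightarrow> d \<le> a"
proof (cases "A = {}")
  case False
  then obtain d where "d \<in> A" "\<forall>a\<in>A. d \<le> a"
    using assms(1) unfolding well_ordered_iff by blast
  with assms(2) show ?thesis
    by (intro that[of d]) auto
qed (use that[of 1] in auto)

definition additive_closure :: "real set \<Rightarrow> real set" where
  "additive_closure A = (\<Union>k. multisums A k)"

text \<open>A positive lower bound d of A forces k-fold sums to be at least k d. So only finitely
  many k contribute below a given element s, and a finite union of well-ordered sumsets is
  well-ordered.\<close>

lemma well_ordered_additive_closure:
  assumes A: "well_ordered A" "A \<subseteq> {0<..}"
  shows "well_ordered (additive_closure A)"
  unfolding well_ordered_iff
proof (intro allI impI)
  obtain d where d: "d > 0" "\<And>a. a \<in> A \<Longrightarrow> d \<le> a"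
    using well_ordered_positive_bound[OF A] by blast
  fix S assume S: "S \<subseteq> additive_closure A" "S \<noteq> {}"
  then obtain s where s: "s \<in> S"
    by blast
  obtain K :: nat where K: "s < real K * d"
    using d(1) reals_Archimedean3 by blast
  have wK: "well_ordered (\<Union>k\<le>K. multisums A k)" for K
    by (induction K) (auto simp: well_ordered_multisums A atMost_Suc well_ordered_Un well_ordered_finite)
  have "{x\<in>S. x \<le> s} \<subseteq> (\<Union>k\<le>K. multisums A k)"
  proof
    fix x assume x: "x \<in> {x\<in>S. x \<le> s}"
    with S obtain k where k: "x \<in> multisums A k"
      by (auto simp: additive_closure_def)
    from multisums_lower_bound[OF d(2) this] x K have "real k * d < real K * d"
      by auto
    with d(1) have "k \<le> K"
      by simp
    with k show "x \<in> (\<Union>k\<le>K. multisums A k)"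
      by auto
  qed
  then obtain z where z: "z \<in> {x\<in>S. x \<le> s}" "\<forall>y\<in>{x\<in>S. x \<le> s}. z \<le> y"
    using wK[of K] s unfolding well_ordered_iff by (metis (mono_tags, lifting) empty_iff mem_Collect_eq order_refl)
  have "z \<le> y" if "y \<in> S" for y
    using z that by (cases "y \<le> s") auto
  with z show "\<exists>z\<in>S. \<forall>y\<in>S. z \<le> y"
    by blast
qed

lemma zero_in_additive_closure: "0 \<in> additive_closure A"
  unfolding additive_closure_def by (rule UN_I[of 0]) auto

lemma additive_closure_add:
  "x \<in> additive_closure A \<Longrightarrow> y \<in> additive_closure A \<Longrightarrow> x + y \<in> additive_closure A"
  by (auto simp: additive_closure_def) (metis multisums_add)

lemma additive_closure_nonneg:
  assumes "A \<subseteq> {0<..}"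
  shows "additive_closure A \<subseteq> {0..}"
  using multisums_lower_bound[of A 0] assms by (fastforce simp: additive_closure_def)

lemma additive_closure_subset:
  assumes "A \<subseteq> J" "0 \<in> J" "\<And>x y. x \<in> J \<Longrightarrow> y \<in> J \<Longrightarrow> x + y \<in> J"
  shows "additive_closure A \<subseteq> J"
proof -
  have "multisums A k \<subseteq> J" for k
    using assms by (induction k) (auto simp: multisums_Suc set_plus_def)
  then show ?thesis
    by (auto simp: additive_closure_def)
qed

lemma finite_fibre_three:
  assumes "well_ordered A" "well_ordered B" "well_ordered C"
  shows "finite {(x, y). x \<in> A \<and> y \<in> B \<and> e - x - y \<in> C}"
proof -
  let ?X = "{x\<in>A. e - x \<in> B + C}"
  have "finite ?X"
    using assms by (intro finite_fibre well_ordered_sumset)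
  moreover have "finite {y\<in>B. e - x - y \<in> C}" for x
    using assms by (intro finite_fibre)
  ultimately have "finite (SIGMA x:?X. {y\<in>B. e - x - y \<in> C})"
    by blast
  then show ?thesis
  proof (rule finite_subset[rotated])
    show "{(x, y). x \<in> A \<and> y \<in> B \<and> e - x - y \<in> C} \<subseteq> (SIGMA x:?X. {y\<in>B. e - x - y \<in> C})"
      by (auto simp: set_plus_def) (metis add.commute diff_add_cancel)
  qed
qed

text \<open>Here x is the partial sum of the first two terms, the form in which iterated
  convolutions and substitutions present their index pairs.\<close>

lemma finite_fibre_three':
  assumes "well_ordered A" "well_ordered B" "well_ordered C"
  shows "finite {(x, y). y \<in> A \<and> x - y \<in> B \<and> e - x \<in> C}"
proof -
  have "{(x, y). y \<in> A \<and> x - y \<in> B \<and> e - x \<in> C} =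
        (\<lambda>(y, z). (y + z, y)) ` {(y, z). y \<in> A \<and> z \<in> B \<and> e - y - z \<in> C}"
    by (force simp: algebra_simps image_def)
  then show ?thesis
    using finite_fibre_three[OF assms] by simp
qed

section \<open>Rearrangement of finitely supported sums\<close>

lemma Sum_any_swap:
  fixes g :: "'a \<Rightarrow> 'b \<Rightarrow> 'c::comm_monoid_add"
  assumes "finite {(a, b). g a b \<noteq> 0}"
  shows "Sum_any (\<lambda>a. Sum_any (\<lambda>b. g a b)) = Sum_any (\<lambda>b. Sum_any (\<lambda>a. g a b))"
proof (rule Sum_any.swap)
  have "{a. \<exists>b. g a b \<noteq> 0} = fst ` {(a, b). g a b \<noteq> 0}" "{b. \<exists>a. g a b \<noteq> 0} = snd ` {(a, b). g a b \<noteq> 0}"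
    by force+
  with assms show "finite ({a. \<exists>b. g a b \<noteq> 0} \<times> {b. \<exists>a. g a b \<noteq> 0})"
    by simp
qed auto

lemma Sum_any_single:
  assumes "\<And>b. b \<noteq> a \<Longrightarrow> g b = 0"
  shows "Sum_any g = g a"
proof -
  have "Sum_any g = sum g {a}"
    by (rule Sum_any.expand_superset) (use assms in auto)
  then show ?thesis
    by simp
qed

text \<open>A nonzero factor leaves the set of nonzero summands unchanged, so both sides agree even
  when that set is infinite and \<open>Sum_any\<close> takes the value 0.\<close>

lemma Sum_any_mult_left:
  fixes g :: "'b \<Rightarrow> 'a::{semiring_0, semiring_no_zero_divisors}"
  shows "Sum_any (\<lambda>n. r * g n) = r * Sum_any g"
proof (cases "r = 0")
  case False
  then have "{n. r * g n \<noteq> 0} = {n. g n \<noteq> 0}"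
    by auto
  then show ?thesis
    by (simp add: Sum_any.expand_set sum_distrib_left)
qed simp

lemma Sum_any_mult_right:
  fixes g :: "'b \<Rightarrow> 'a::{semiring_0, semiring_no_zero_divisors}"
  shows "Sum_any (\<lambda>n. g n * r) = Sum_any g * r"
proof (cases "r = 0")
  case False
  then have "{n. g n * r \<noteq> 0} = {n. g n \<noteq> 0}"
    by auto
  then show ?thesis
    by (simp add: Sum_any.expand_set sum_distrib_right)
qed simp

lemma Sum_any_shift:
  fixes g :: "real \<Rightarrow> 'a::comm_monoid_add"
  shows "Sum_any (\<lambda>x. g (x - b)) = Sum_any g"
proof (rule Sum_any.reindex_cong[of "\<lambda>x. x + b"])
  show "bij (\<lambda>x::real. x + b)"
    by (rule o_bij[of "\<lambda>x. x - b"]) auto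
qed auto

lemma Sum_any_reflect:
  fixes g :: "real \<Rightarrow> 'a::comm_monoid_add"
  shows "Sum_any (\<lambda>x. g (b - x)) = Sum_any g"
proof (rule Sum_any.reindex_cong[of "\<lambda>x. b - x"])
  show "bij (\<lambda>x::real. b - x)"
    by (rule o_bij[of "\<lambda>x. b - x"]) auto
qed auto

section \<open>The ring of series with well-ordered support\<close>

text \<open>These are the Hahn series with real exponents. A type gives access to the laws and
  powers of \<open>comm_ring_1\<close>; since \<open>art_mult\<close> is its product,
  \<open>coef\<close> leads back to the given definitions.\<close>

typedef hahn = "{f :: art_series. well_ordered {x. f x \<noteq> 0}}"
  morphisms coef Hahn
  by (rule exI[of _ "\<lambda>_. 0"]) (auto simp: wfp_on_def)

setup_lifting type_definition_hahn

definition support :: "hahn \<Rightarrow> real set" where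
  "support g = {x. coef g x \<noteq> 0}"

lemma well_ordered_support: "well_ordered (support g)"
  using coef[of g] by (simp add: support_def)

lemma coef_Hahn: "well_ordered {x. f x \<noteq> 0} \<Longrightarrow> coef (Hahn f) = f"
  by (simp add: Hahn_inverse)

lemma hahn_eqI: "(\<And>e. coef g e = coef h e) \<Longrightarrow> g = h"
  by (simp add: coef_inject[symmetric] fun_eq_iff)

lemma well_ordered_support_mono:
  assumes "well_ordered A" "\<And>x. f x \<noteq> 0 \<Longrightarrow> x \<in> A"
  shows "well_ordered {x. f x \<noteq> 0}"
  using assms(1) by (rule wfp_on_subset) (use assms(2) in auto)

lemma finite_convolution:
  assumes "well_ordered {x. g x \<noteq> 0}" "well_ordered {x. h x \<noteq> 0}"
  shows "finite {a. g a * (h (e - a) :: complex) \<noteq> 0}"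
  using finite_fibre[OF assms, of e] by simp

lemma art_mult_nonzero:
  assumes "art_mult g h e \<noteq> 0"
  obtains a where "g a \<noteq> 0" "h (e - a) \<noteq> 0"
  using Sum_any.not_neutral_obtains_not_neutral[OF assms[unfolded art_mult_def]] that by auto

lemma well_ordered_art_mult:
  assumes "well_ordered {x. g x \<noteq> 0}" "well_ordered {x. h x \<noteq> 0}"
  shows "well_ordered {x. art_mult g h x \<noteq> 0}"
proof (rule well_ordered_support_mono)
  show "well_ordered ({x. g x \<noteq> 0} + {x. h x \<noteq> 0})"
    using assms by (rule well_ordered_sumset)
  fix x assume "art_mult g h x \<noteq> 0"
  then obtain a where "g a \<noteq> 0" "h (x - a) \<noteq> 0"
    by (rule art_mult_nonzero)
  then show "x \<in> {x. g x \<noteq> 0} + {x. h x \<noteq> 0}"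
    using set_plus_intro[of a "{x. g x \<noteq> 0}" "x - a" "{x. h x \<noteq> 0}"] by simp
qed

instantiation hahn :: comm_ring_1
begin

lift_definition zero_hahn :: hahn is "\<lambda>_. 0"
  by (simp add: wfp_on_def)

lift_definition one_hahn :: hahn is art_one
  by (rule well_ordered_finite, rule finite_subset[of _ "{0}"]) (auto simp: art_one_def)

lift_definition plus_hahn :: "hahn \<Rightarrow> hahn \<Rightarrow> hahn" is "\<lambda>g h x. g x + h x"
  by (rule well_ordered_support_mono[OF well_ordered_Un], assumption+) auto

lift_definition minus_hahn :: "hahn \<Rightarrow> hahn \<Rightarrow> hahn" is "\<lambda>g h x. g x - h x"
  by (rule well_ordered_support_mono[OF well_ordered_Un], assumption+) auto

lift_definition uminus_hahn :: "hahn \<Rightarrow> hahn" is "\<lambda>g x. - g x"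
  by simp

lift_definition times_hahn :: "hahn \<Rightarrow> hahn \<Rightarrow> hahn" is art_mult
  by (rule well_ordered_art_mult)

lemma coef_times: "coef (g * h) e = Sum_any (\<lambda>a. coef g a * coef h (e - a))"
  by (simp add: times_hahn.rep_eq art_mult_def)

lemma finite_coef_times: "finite {a. coef g a * coef h (e - a) \<noteq> 0}"
  using finite_convolution coef by auto

instance
proof
  fix g h k :: hahn
  show "g + h + k = g + (h + k)" "g + h = h + g" "0 + g = g" "- g + g = 0" "g - h = g + - h"
    by (transfer, simp add: algebra_simps)+
  show comm: "g * h = h * g" for g h :: hahn
  proof (rule hahn_eqI)
    fix e
    have "coef (g * h) e = Sum_any (\<lambda>a. coef g (e - a) * coef h (e - (e - a)))"
      unfolding coef_times by (rule Sum_any_reflect[symmetric])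
    then show "coef (g * h) e = coef (h * g) e"
      by (simp add: coef_times mult.commute)
  qed
  show "g * h * k = g * (h * k)"
  proof (rule hahn_eqI)
    fix e
    have "coef (g * h * k) e = Sum_any (\<lambda>a. Sum_any (\<lambda>b. coef g b * coef h (a - b) * coef k (e - a)))"
      by (simp only: coef_times Sum_any_mult_right[symmetric])
    also have "\<dots> = Sum_any (\<lambda>b. Sum_any (\<lambda>a. coef g b * coef h (a - b) * coef k (e - a)))"
    proof (rule Sum_any_swap)
      show "finite {(a, b). coef g b * coef h (a - b) * coef k (e - a) \<noteq> 0}"
        using finite_fibre_three'[OF well_ordered_support[of g] well_ordered_support[of h]
            well_ordered_support[of k], of e]
        by (simp add: support_def conj_assoc)
    qed
    also have "\<dots> = Sum_any (\<lambda>b. coef g b * Sum_any (\<lambda>c. coef h c * coef k (e - b - c)))"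
    proof (rule Sum_any.cong)
      fix b
      have "Sum_any (\<lambda>a. coef g b * coef h (a - b) * coef k (e - a)) =
            Sum_any (\<lambda>a. coef g b * coef h (a - b) * coef k (e - b - (a - b)))"
        by (simp add: algebra_simps)
      also have "\<dots> = Sum_any (\<lambda>c. coef g b * coef h c * coef k (e - b - c))"
        by (rule Sum_any_shift)
      finally show "Sum_any (\<lambda>a. coef g b * coef h (a - b) * coef k (e - a)) =
            coef g b * Sum_any (\<lambda>c. coef h c * coef k (e - b - c))"
        by (simp only: Sum_any_mult_left[symmetric] mult.assoc)
    qed
    also have "\<dots> = coef (g * (h * k)) e"
      by (simp only: coef_times)
    finally show "coef (g * h * k) e = coef (g * (h * k)) e" .
  qed
  show "1 * g = g"
  proof (rule hahn_eqI)
    fix e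
    show "coef (1 * g) e = coef g e"
      unfolding coef_times one_hahn.rep_eq
      by (subst Sum_any_single[of 0]) (auto simp: art_one_def)
  qed
  show "(g + h) * k = g * k + h * k"
    by (rule hahn_eqI)
       (simp add: coef_times plus_hahn.rep_eq ring_distribs
          Sum_any.distrib[OF finite_coef_times finite_coef_times])
  show "(0 :: hahn) \<noteq> 1"
    by transfer (auto simp: art_one_def fun_eq_iff)
qed

end

lemmas coef_simps [simp] =
  zero_hahn.rep_eq plus_hahn.rep_eq minus_hahn.rep_eq uminus_hahn.rep_eq

lemma coef_one: "coef 1 e = of_bool (e = 0)"
  by (simp add: one_hahn.rep_eq art_one_def)

lemma coef_sum: "coef (sum g A) e = (\<Sum>a\<in>A. coef (g a) e)"
  by (induction A rule: infinite_finite_induct) auto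

lemma coef_of_nat_times: "coef (of_nat n * g) e = of_nat n * coef g e"
  by (induction n) (auto simp: algebra_simps)

lemma support_times: "support (g * h) \<subseteq> support g + support h"
proof
  fix x assume "x \<in> support (g * h)"
  then obtain a where "coef g a \<noteq> 0" "coef h (x - a) \<noteq> 0"
    by (auto simp: support_def times_hahn.rep_eq elim: art_mult_nonzero)
  then show "x \<in> support g + support h"
    using set_plus_intro[of a "support g" "x - a" "support h"] by (simp add: support_def)
qed

lemma support_power: "support (g ^ k) \<subseteq> multisums (support g) k"
proof (induction k)
  case 0
  show ?case
    by (auto simp: support_def coef_one)
next
  case (Suc k)
  have "support (g ^ Suc k) \<subseteq> support g + support (g ^ k)"
    by (simp add: support_times)
  also have "\<dots> \<subseteq> support g + multisums (support g) k"
    by (intro set_plus_mono2 Suc) simp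
  finally show ?case
    by (simp only: multisums_Suc)
qed

lift_definition hahn_monom :: "complex \<Rightarrow> real \<Rightarrow> hahn" is "\<lambda>c a x. if x = a then c else 0"
  by (rule well_ordered_finite, rule finite_subset) auto

lemma coef_hahn_monom: "coef (hahn_monom c a) x = (if x = a then c else 0)"
  by transfer simp

lemma coef_hahn_monom_times: "coef (hahn_monom c a * g) e = c * coef g (e - a)"
  unfolding coef_times by (subst Sum_any_single[of a]) (auto simp: coef_hahn_monom)

lemma hahn_monom_mult: "hahn_monom c a * hahn_monom d b = hahn_monom (c * d) (a + b)"
  by (rule hahn_eqI) (auto simp: coef_hahn_monom_times coef_hahn_monom)

lemma one_eq_hahn_monom: "1 = hahn_monom 1 0"
  by (rule hahn_eqI) (auto simp: coef_hahn_monom coef_one)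

section \<open>Binomial series\<close>

definition polyfun :: "(complex \<Rightarrow> complex) \<Rightarrow> bool" where
  "polyfun \<phi> \<longleftrightarrow> (\<exists>p. \<phi> = poly p)"

lemma polyfun_const: "polyfun (\<lambda>_. c)"
  unfolding polyfun_def by (rule exI[of _ "[:c:]"]) auto

lemma polyfun_add:
  assumes "polyfun \<phi>" "polyfun \<psi>"
  shows "polyfun (\<lambda>x. \<phi> x + \<psi> x)"
proof -
  obtain p q where "\<phi> = poly p" "\<psi> = poly q"
    using assms by (auto simp: polyfun_def)
  then show ?thesis
    unfolding polyfun_def by (intro exI[of _ "p + q"]) auto
qed

lemma polyfun_mult:
  assumes "polyfun \<phi>" "polyfun \<psi>"
  shows "polyfun (\<lambda>x. \<phi> x * \<psi> x)"
proof -
  obtain p q where "\<phi> = poly p" "\<psi> = poly q"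
    using assms by (auto simp: polyfun_def)
  then show ?thesis
    unfolding polyfun_def by (intro exI[of _ "p * q"]) auto
qed

lemma polyfun_sum: "(\<And>a. a \<in> A \<Longrightarrow> polyfun (\<phi> a)) \<Longrightarrow> polyfun (\<lambda>x. \<Sum>a\<in>A. \<phi> a x)"
  by (induction A rule: infinite_finite_induct) (auto intro: polyfun_const polyfun_add)

lemma polyfun_gchoose: "polyfun (\<lambda>x. x gchoose k)"
proof -
  have "polyfun (\<lambda>x. \<Prod>i=0..<k. x - of_nat i)" for k
  proof (induction k)
    case (Suc k)
    have "polyfun (\<lambda>x. x - of_nat k)"
      unfolding polyfun_def by (rule exI[of _ "[:- of_nat k, 1:]"]) auto
    with Suc show ?case
      by (simp add: polyfun_mult)
  qed (simp add: polyfun_const)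
  then show ?thesis
    unfolding gbinomial_prod_rev divide_inverse by (rule polyfun_mult) (rule polyfun_const)
qed

lemma polyfun_shift:
  assumes "polyfun \<phi>"
  shows "polyfun (\<lambda>x. \<phi> (x + c))"
proof -
  obtain p where "\<phi> = poly p"
    using assms by (auto simp: polyfun_def)
  then show ?thesis
    unfolding polyfun_def by (intro exI[of _ "pcompose p [:c, 1:]"]) (auto simp: poly_pcompose add.commute)
qed

text \<open>The difference of the two polynomials vanishes at all natural numbers, hence has
  infinitely many roots.\<close>

lemma polyfun_eqI:
  assumes "polyfun \<phi>" "polyfun \<psi>" "\<And>n. \<phi> (of_nat n) = \<psi> (of_nat n)"
  shows "\<phi> c = \<psi> c"
proof -
  obtain p q where pq: "\<phi> = poly p" "\<psi> = poly q"
    using assms by (auto simp: polyfun_def)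
  have "range of_nat \<subseteq> {x. poly (p - q) x = 0}"
    using assms(3) pq by auto
  then have "infinite {x. poly (p - q) x = 0}"
    using finite_subset infinite_UNIV_char_0 finite_imageD inj_of_nat by blast
  then have "p = q"
    using poly_roots_finite[of "p - q"] by auto
  with pq show ?thesis
    by simp
qed

text \<open>This is the formal power (1 + u)^c. For positive u each coefficient is a finite sum and
  the exponents lie in the additive closure of the support of u, so \<open>Hahn\<close> is applied
  to an admissible function.\<close>

definition binomial_series :: "hahn \<Rightarrow> complex \<Rightarrow> hahn" where
  "binomial_series u c = Hahn (\<lambda>e. Sum_any (\<lambda>k. (c gchoose k) * coef (u ^ k) e))"

definition positive :: "hahn \<Rightarrow> bool" where
  "positive u \<longleftrightarrow> support u \<subseteq> {0<..}"

text \<open>If d > 0 bounds the support of u from below, u^k has no exponent below k d, so only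
  finitely many powers reach e.\<close>

lemma positive_finite_powers:
  assumes "positive u"
  shows "finite {k. coef (u ^ k) e \<noteq> 0}"
proof -
  obtain d where d: "d > 0" "\<And>a. a \<in> support u \<Longrightarrow> d \<le> a"
    using well_ordered_positive_bound[OF well_ordered_support] assms positive_def by metis
  obtain K :: nat where K: "e < real K * d"
    using d(1) reals_Archimedean3 by blast
  have "k \<le> K" if "coef (u ^ k) e \<noteq> 0" for k
  proof -
    have "e \<in> multisums (support u) k"
      using that support_power[of u k] by (auto simp: support_def)
    from multisums_lower_bound[OF d(2) this] K have "real k * d < real K * d"
      by auto
    with d(1) show ?thesis
      by simp
  qed
  then show ?thesis
    by (meson finite_nat_set_iff_bounded_le mem_Collect_eq)
qed

context
  fixes u assumes u: "positive u"
begin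

private lemma binomial_sum_support:
  assumes "Sum_any (\<lambda>k. (c gchoose k) * coef (u ^ k) e) \<noteq> 0"
  shows "e \<in> additive_closure (support u)"
proof -
  obtain k where "coef (u ^ k) e \<noteq> 0"
    using Sum_any.not_neutral_obtains_not_neutral[OF assms] by auto
  then show ?thesis
    using support_power[of u k] by (auto simp: additive_closure_def support_def)
qed

lemma well_ordered_closure_support: "well_ordered (additive_closure (support u))"
  using u by (intro well_ordered_additive_closure well_ordered_support) (auto simp: positive_def)

lemma coef_binomial_series:
  "coef (binomial_series u c) e = Sum_any (\<lambda>k. (c gchoose k) * coef (u ^ k) e)"
  unfolding binomial_series_def
  by (subst coef_Hahn)
     (auto intro: well_ordered_support_mono[OF well_ordered_closure_support] binomial_sum_support)

lemma support_binomial_series: "support (binomial_series u c) \<subseteq> additive_closure (support u)"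
  by (auto simp: support_def[of "binomial_series u c"] coef_binomial_series binomial_sum_support)

lemma coef_binomial_series_0: "coef (binomial_series u c) 0 = 1"
proof -
  have "coef (u ^ k) 0 = 0" if k: "k \<noteq> 0" for k
  proof (rule ccontr)
    assume "coef (u ^ k) 0 \<noteq> 0"
    then have "0 \<in> multisums (support u) k"
      using support_power[of u k] by (auto simp: support_def)
    moreover obtain d where d: "d > 0" "\<And>a. a \<in> support u \<Longrightarrow> d \<le> a"
      using well_ordered_positive_bound[OF well_ordered_support] u positive_def by metis
    ultimately have "real k * d \<le> 0"
      using multisums_lower_bound by blast
    with d k show False
      by (simp add: mult_le_0_iff)
  qed
  then have "coef (binomial_series u c) 0 = (c gchoose 0) * coef (u ^ 0) 0"
    unfolding coef_binomial_series by (intro Sum_any_single) auto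
  then show ?thesis
    by (simp add: coef_one)
qed

text \<open>The finite set of relevant k depends on u and e but not on c, and each summand is a
  polynomial in c.\<close>

lemma polyfun_binomial_series: "polyfun (\<lambda>c. coef (binomial_series u c) e)"
proof -
  have "coef (binomial_series u c) e =
        (\<Sum>k\<in>{k. coef (u ^ k) e \<noteq> 0}. (c gchoose k) * coef (u ^ k) e)" for c
    unfolding coef_binomial_series
    by (rule Sum_any.expand_superset[OF positive_finite_powers[OF u]]) auto
  then show ?thesis
    by (simp add: polyfun_sum polyfun_mult polyfun_const polyfun_gchoose)
qed

lemma binomial_series_of_nat: "binomial_series u (of_nat n) = (1 + u) ^ n"
proof (rule hahn_eqI)
  fix e
  have "coef (binomial_series u (of_nat n)) e = (\<Sum>k\<le>n. (of_nat n gchoose k) * coef (u ^ k) e)"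
    unfolding coef_binomial_series
    by (rule Sum_any.expand_superset) (auto simp: binomial_gbinomial[symmetric] not_le)
  also have "\<dots> = coef (\<Sum>k\<le>n. of_nat (n choose k) * u ^ k) e"
    by (simp add: coef_sum coef_of_nat_times binomial_gbinomial)
  also have "(\<Sum>k\<le>n. of_nat (n choose k) * u ^ k) = (1 + u) ^ n"
    by (subst add.commute) (simp add: binomial_ring)
  finally show "coef (binomial_series u (of_nat n)) e = coef ((1 + u) ^ n) e" .
qed

end

text \<open>The bounds A and B for the supports do not depend on c, so the convolution runs over one
  fixed finite set.\<close>

lemma polyfun_coef_times:
  assumes "well_ordered A" "well_ordered B"
    and "\<And>c. support (G c) \<subseteq> A" "\<And>c. support (H c) \<subseteq> B"
    and "\<And>e. polyfun (\<lambda>c. coef (G c) e)" "\<And>e. polyfun (\<lambda>c. coef (H c) e)"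
  shows "polyfun (\<lambda>c. coef (G c * H c) e)"
proof -
  have "coef (G c * H c) e = (\<Sum>a\<in>{a\<in>A. e - a \<in> B}. coef (G c) a * coef (H c) (e - a))" for c
    unfolding coef_times
  proof (rule Sum_any.expand_superset)
    show "finite {a \<in> A. e - a \<in> B}"
      using assms(1,2) by (rule finite_fibre)
    show "{a. coef (G c) a * coef (H c) (e - a) \<noteq> 0} \<subseteq> {a \<in> A. e - a \<in> B}"
      using assms(3,4) by (auto simp: support_def)
  qed
  then show ?thesis
    by (simp add: polyfun_sum polyfun_mult assms(5,6))
qed

lemma binomial_series_add:
  assumes u: "positive u"
  shows "binomial_series u (a + b) = binomial_series u a * binomial_series u b"
proof (rule hahn_eqI)
  fix e
  have poly: "polyfun (\<lambda>c. coef (binomial_series u c * g) e)" for g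
    by (rule polyfun_coef_times[OF well_ordered_closure_support[OF u] well_ordered_support[of g]])
       (auto intro: polyfun_const polyfun_binomial_series[OF u] dest: subsetD[OF support_binomial_series[OF u]])
  have shift: "polyfun (\<lambda>c. coef (binomial_series u (c + b)) e)" for b
    by (intro polyfun_shift polyfun_binomial_series u)
  \<comment> \<open>The exponents are freed one at a time: here a becomes arbitrary beside a natural
    exponent, and then the natural exponent is replaced by b in the same way.\<close>
  have nat: "coef (binomial_series u (a + of_nat m)) e =
        coef (binomial_series u a * binomial_series u (of_nat m)) e" for a m
    by (rule polyfun_eqI[OF shift poly])
       (simp only: of_nat_add[symmetric] binomial_series_of_nat[OF u] power_add)
  have "coef (binomial_series u (b + a)) e = coef (binomial_series u b * binomial_series u a) e"
    by (rule polyfun_eqI[OF shift poly]) (simp add: nat add.commute[of _ a] mult.commute)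
  then show "coef (binomial_series u (a + b)) e = coef (binomial_series u a * binomial_series u b) e"
    by (simp add: add.commute mult.commute)
qed

lemma positive_combine:
  assumes "positive u" "positive v"
  shows "positive (u + v + u * v)"
proof -
  have "support (u + v + u * v) \<subseteq> support u \<union> support v \<union> support (u * v)"
    by (auto simp: support_def)
  also have "\<dots> \<subseteq> support u \<union> support v \<union> (support u + support v)"
    using support_times by blast
  also have "\<dots> \<subseteq> {0<..}"
    using assms by (force simp: positive_def set_plus_def)
  finally show ?thesis
    by (simp add: positive_def)
qed

text \<open>For natural c this is the power of the product (1 + u)(1 + v) = 1 + (u + v + u v); both
  sides are coefficientwise polynomial in c.\<close>

lemma binomial_series_mult:
  assumes u: "positive u" and v: "positive v"
  shows "binomial_series u c * binomial_series v c = binomial_series (u + v + u * v) c"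
proof (rule hahn_eqI)
  fix e
  note uv = positive_combine[OF u v]
  show "coef (binomial_series u c * binomial_series v c) e = coef (binomial_series (u + v + u * v) c) e"
  proof (rule polyfun_eqI[OF _ polyfun_binomial_series[OF uv]])
    show "polyfun (\<lambda>c. coef (binomial_series u c * binomial_series v c) e)"
      by (rule polyfun_coef_times[OF well_ordered_closure_support[OF u] well_ordered_closure_support[OF v]])
         (auto intro: polyfun_binomial_series u v dest: subsetD[OF support_binomial_series, rotated])
    show "coef (binomial_series u (of_nat n) * binomial_series v (of_nat n)) e =
          coef (binomial_series (u + v + u * v) (of_nat n)) e" for n
      unfolding binomial_series_of_nat[OF u] binomial_series_of_nat[OF v] binomial_series_of_nat[OF uv]
      by (simp add: power_mult_distrib[symmetric] algebra_simps)
  qed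
qed

lemma binomial_series_zero: "binomial_series 0 c = 1"
proof (rule hahn_eqI)
  fix e
  have "coef (binomial_series 0 c) e = (c gchoose 0) * coef (0 ^ 0) e"
    by (subst coef_binomial_series, simp add: positive_def support_def, rule Sum_any_single)
       (simp add: power_0_left)
  then show "coef (binomial_series 0 c) e = coef 1 e"
    by simp
qed

section \<open>Substitution of a family of powers\<close>

text \<open>An abstract system of real powers of a series of degree 1: \<open>P a\<close> has
  leading exponent a, and all its exponents lie in a + N. Because the same well-ordered monoid N
  serves all a, substitution leads to finite sums only.\<close>

locale power_family =
  fixes P :: "real \<Rightarrow> hahn" and N :: "real set"
  assumes well_ordered_N: "well_ordered N"
    and zero_in_N: "0 \<in> N"
    and N_add: "x \<in> N \<Longrightarrow> y \<in> N \<Longrightarrow> x + y \<in> N"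
    and N_nonneg: "x \<in> N \<Longrightarrow> 0 \<le> x"
    and coef_P_support: "coef (P a) e \<noteq> 0 \<Longrightarrow> e - a \<in> N"
    and coef_P_leading: "coef (P a) a \<noteq> 0"
    and P_add: "P (a + b) = P a * P b"
    and P_zero: "P 0 = 1"
begin

definition subst :: "hahn \<Rightarrow> hahn" where
  "subst G = Hahn (\<lambda>e. Sum_any (\<lambda>a. coef G a * coef (P a) e))"

lemma finite_subst:
  assumes "well_ordered A"
  shows "finite {a\<in>A. coef (P a) e \<noteq> 0}"
  by (rule finite_subset[OF _ finite_fibre[OF assms well_ordered_N, of e]]) (auto intro: coef_P_support)

lemma finite_subst_summands: "finite {a. coef G a * coef (P a) e \<noteq> 0}"
  by (rule finite_subset[OF _ finite_subst[OF well_ordered_support[of G], of e]]) (auto simp: support_def)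

lemma well_ordered_support_plus_N: "well_ordered (support G + N)"
  by (intro well_ordered_sumset well_ordered_support well_ordered_N)

lemma subst_sum_support:
  assumes "Sum_any (\<lambda>a. coef G a * coef (P a) e) \<noteq> 0"
  shows "e \<in> support G + N"
proof -
  obtain a where "coef G a \<noteq> 0" "coef (P a) e \<noteq> 0"
    using Sum_any.not_neutral_obtains_not_neutral[OF assms] by auto
  then show ?thesis
    using set_plus_intro[of a "support G" "e - a" N] coef_P_support by (simp add: support_def)
qed

lemma coef_subst: "coef (subst G) e = Sum_any (\<lambda>a. coef G a * coef (P a) e)"
  unfolding subst_def
  by (subst coef_Hahn) (auto intro: well_ordered_support_mono[OF well_ordered_support_plus_N] subst_sum_support)

lemma support_subst: "support (subst G) \<subseteq> support G + N"
  by (auto simp: support_def[of "subst G"] coef_subst subst_sum_support)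

lemma positive_subst:
  assumes "positive u"
  shows "positive (subst u)"
  unfolding positive_def
proof
  fix x assume "x \<in> support (subst u)"
  then obtain a b where "a \<in> support u" "b \<in> N" "x = a + b"
    using support_subst by (meson set_plus_elim subsetD)
  then show "x \<in> {0<..}"
    using assms N_nonneg[of b] by (fastforce simp: positive_def)
qed

lemma subst_add: "subst (G + H) = subst G + subst H"
  by (rule hahn_eqI)
     (simp add: coef_subst ring_distribs Sum_any.distrib[OF finite_subst_summands finite_subst_summands])

lemma subst_hahn_monom: "subst (hahn_monom c a) = hahn_monom c 0 * P a"
  by (rule hahn_eqI) (simp add: coef_subst coef_hahn_monom_times coef_hahn_monom Sum_any_single[of a])

lemma subst_one: "subst 1 = 1"
  by (simp add: one_eq_hahn_monom subst_hahn_monom P_zero) (simp add: one_eq_hahn_monom[symmetric])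

text \<open>A monomial factor shifts the exponents by b, and the shift is absorbed by
  \<open>P_add\<close>. Summing this over the monomials of G gives
  \<open>subst_times\<close>.\<close>

lemma subst_hahn_monom_times: "subst (hahn_monom c b * H) = hahn_monom c 0 * (P b * subst H)"
proof (rule hahn_eqI)
  fix e
  have "coef (subst (hahn_monom c b * H)) e = Sum_any (\<lambda>a. c * coef H (a - b) * coef (P (a - b + b)) e)"
    by (simp add: coef_subst coef_hahn_monom_times)
  also have "\<dots> = Sum_any (\<lambda>a. c * coef H a * coef (P (a + b)) e)"
    by (rule Sum_any_shift)
  also have "\<dots> = c * Sum_any (\<lambda>a. coef H a * coef (P b * P a) e)"
    by (simp only: P_add mult.commute[of "P b"] Sum_any_mult_left[symmetric] mult.assoc)
  also have "Sum_any (\<lambda>a. coef H a * coef (P b * P a) e) =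
             Sum_any (\<lambda>a. Sum_any (\<lambda>x. coef H a * (coef (P b) x * coef (P a) (e - x))))"
    by (simp only: coef_times Sum_any_mult_left)
  also have "\<dots> = Sum_any (\<lambda>x. Sum_any (\<lambda>a. coef H a * (coef (P b) x * coef (P a) (e - x))))"
  proof (rule Sum_any_swap)
    have "finite {(a, x). a \<in> support H \<and> x \<in> support (P b) \<and> e - a - x \<in> N}"
      by (intro finite_fibre_three well_ordered_support well_ordered_N)
    then show "finite {(a, x). coef H a * (coef (P b) x * coef (P a) (e - x)) \<noteq> 0}"
      by (rule finite_subset[rotated])
         (use coef_P_support[of _ "e - _"] in \<open>auto simp: support_def algebra_simps\<close>)
  qed
  also have "\<dots> = Sum_any (\<lambda>x. Sum_any (\<lambda>a. coef (P b) x * (coef H a * coef (P a) (e - x))))"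
    by (simp only: mult.left_commute)
  also have "\<dots> = coef (P b * subst H) e"
    by (simp only: coef_times coef_subst Sum_any_mult_left)
  finally show "coef (subst (hahn_monom c b * H)) e = coef (hahn_monom c 0 * (P b * subst H)) e"
    by (simp add: coef_hahn_monom_times)
qed

lemma subst_times: "subst (G * H) = subst G * subst H"
proof (rule hahn_eqI)
  fix e
  have "coef (subst (G * H)) e = Sum_any (\<lambda>a. Sum_any (\<lambda>b. coef G b * coef H (a - b) * coef (P a) e))"
    by (simp only: coef_subst coef_times Sum_any_mult_right)
  also have "\<dots> = Sum_any (\<lambda>b. Sum_any (\<lambda>a. coef G b * coef H (a - b) * coef (P a) e))"
  proof (rule Sum_any_swap)
    have "finite {(a, b). b \<in> support G \<and> a - b \<in> support H \<and> e - a \<in> N}"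
      by (intro finite_fibre_three' well_ordered_support well_ordered_N)
    then show "finite {(a, b). coef G b * coef H (a - b) * coef (P a) e \<noteq> 0}"
      by (rule finite_subset[rotated]) (auto simp: support_def coef_P_support)
  qed
  \<comment> \<open>For fixed b the inner sum is the substitution into the single monomial of
    exponent b times H, where multiplicativity is already known.\<close>
  also have "\<dots> = Sum_any (\<lambda>b. coef G b * coef (subst (hahn_monom 1 b * H)) e)"
    by (simp add: coef_subst coef_hahn_monom_times Sum_any_mult_left[symmetric] mult.assoc)
  also have "\<dots> = Sum_any (\<lambda>b. Sum_any (\<lambda>x. coef G b * (coef (P b) x * coef (subst H) (e - x))))"
    by (simp add: subst_hahn_monom_times one_eq_hahn_monom[symmetric] coef_times Sum_any_mult_left)
  also have "\<dots> = Sum_any (\<lambda>x. Sum_any (\<lambda>b. coef G b * (coef (P b) x * coef (subst H) (e - x))))"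
  proof (rule Sum_any_swap)
    have "finite {(x, b). b \<in> support G \<and> x - b \<in> N \<and> e - x \<in> support (subst H)}"
      by (intro finite_fibre_three' well_ordered_support well_ordered_N)
    then have "finite {(x, b). coef G b * (coef (P b) x * coef (subst H) (e - x)) \<noteq> 0}"
      by (rule finite_subset[rotated]) (auto simp: support_def coef_P_support)
    then have "finite (prod.swap ` {(x, b). coef G b * (coef (P b) x * coef (subst H) (e - x)) \<noteq> 0})"
      by (rule finite_imageI)
    then show "finite {(b, x). coef G b * (coef (P b) x * coef (subst H) (e - x)) \<noteq> 0}"
      by (rule finite_subset[rotated]) (auto simp: image_iff)
  qed
  also have "\<dots> = coef (subst G * subst H) e"
    by (simp only: coef_times[of "subst G"] coef_subst[of G] Sum_any_mult_right mult.assoc[symmetric])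
  finally show "coef (subst (G * H)) e = coef (subst G * subst H) e" .
qed

lemma subst_power: "subst (G ^ n) = subst G ^ n"
  by (induction n) (auto simp: subst_one subst_times)

text \<open>For natural c both sides are powers and \<open>subst\<close> is a ring homomorphism.
  Each coefficient of the left side sums over a finite set independent of c, so it is polynomial in
  c.\<close>

lemma subst_binomial_series:
  assumes v: "positive v"
  shows "subst (binomial_series v c) = binomial_series (subst v) c"
proof (rule hahn_eqI)
  fix e
  show "coef (subst (binomial_series v c)) e = coef (binomial_series (subst v) c) e"
  proof (rule polyfun_eqI[of "\<lambda>c. coef (subst (binomial_series v c)) e"])
    let ?A = "{a\<in>additive_closure (support v). coef (P a) e \<noteq> 0}"
    have "coef (subst (binomial_series v c)) e = (\<Sum>a\<in>?A. coef (binomial_series v c) a * coef (P a) e)" for c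
      unfolding coef_subst
    proof (rule Sum_any.expand_superset)
      show "finite ?A"
        by (intro finite_subst well_ordered_closure_support v)
      show "{a. coef (binomial_series v c) a * coef (P a) e \<noteq> 0} \<subseteq> ?A"
        using support_binomial_series[OF v, of c] by (auto simp: support_def)
    qed
    then show "polyfun (\<lambda>c. coef (subst (binomial_series v c)) e)"
      by (simp add: polyfun_sum polyfun_mult polyfun_const polyfun_binomial_series v)
    show "polyfun (\<lambda>c. coef (binomial_series (subst v) c) e)"
      by (intro polyfun_binomial_series positive_subst v)
    show "coef (subst (binomial_series v (of_nat n))) e = coef (binomial_series (subst v) (of_nat n)) e" for n
      by (simp add: binomial_series_of_nat v positive_subst subst_power subst_add subst_one)
  qed
qed

text \<open>Since \<open>P b\<close> has no exponents below b, only b = a can contribute at the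
  least exponent a.\<close>

lemma coef_subst_least:
  assumes "\<And>b. b \<in> support G \<Longrightarrow> a \<le> b"
  shows "coef (subst G) a = coef G a * coef (P a) a"
  unfolding coef_subst
proof (rule Sum_any_single)
  fix b assume "b \<noteq> a"
  show "coef G b * coef (P b) a = 0"
  proof (rule ccontr)
    assume "coef G b * coef (P b) a \<noteq> 0"
    then have "b \<in> support G" "a - b \<in> N"
      by (auto simp: support_def coef_P_support)
    with \<open>b \<noteq> a\<close> assms[of b] N_nonneg[of "a - b"] show False
      by simp
  qed
qed

lemma least_exponent:
  assumes "G \<noteq> 0"
  obtains a where "coef G a \<noteq> 0" "\<And>b. b \<in> support G \<Longrightarrow> a \<le> b" "coef (subst G) a \<noteq> 0"
proof -
  have "support G \<noteq> {}"
    using assms hahn_eqI[of G 0] by (auto simp: support_def)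
  then obtain a where a: "a \<in> support G" "\<forall>b\<in>support G. a \<le> b"
    using well_ordered_support[of G] unfolding well_ordered_iff by blast
  with coef_subst_least[of G a] coef_P_leading[of a] show ?thesis
    by (intro that[of a]) (auto simp: support_def)
qed

text \<open>If G - H were nonzero, its least exponent would survive the substitution, because the
  leading coefficients of the powers do not vanish.\<close>

lemma subst_inject:
  assumes "subst G = subst H"
  shows "G = H"
proof (rule ccontr)
  assume "G \<noteq> H"
  have "subst (G - H) + subst H = subst H"
    using assms by (simp add: subst_add[symmetric])
  with \<open>G \<noteq> H\<close> least_exponent[of "G - H"] show False
    by auto
qed

text \<open>The coefficients of a preimage are found by recursion along the well-ordered set of exponents.\<close>

lemma subst_surj:
  obtains G where "subst G = T"
proof -
  \<comment> \<open>The preimage is sought with exponents in \<open>W\<close>. This set contains the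
    exponents of T and, as \<open>step\<close> below shows, all exponents of \<open>P a\<close> for
    a in \<open>W\<close>.\<close>
  define W where "W = support T + N"
  define R where "R = {(a, e). a < e \<and> a \<in> W \<and> e \<in> W}"
  have wW: "well_ordered W"
    unfolding W_def by (rule well_ordered_support_plus_N)
  then have "wf R"
    using wfp_on_iff_wfp[of W "(<)"] by (simp add: R_def wfp_def)
  \<comment> \<open>The system for the coefficients is triangular with diagonal entries
    \<open>coef (P e) e\<close>. \<open>F\<close> solves the equation at e in terms of the values at
    smaller exponents.\<close>
  define F where "F = (\<lambda>\<phi> e. (coef T e - Sum_any (\<lambda>a. if (a, e) \<in> R then \<phi> a * coef (P a) e else 0)) / coef (P e) e)"
  define \<gamma> where "\<gamma> = wfrec R F"
  have \<gamma>: "\<gamma> e = F \<gamma> e" for e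
  proof -
    have "\<gamma> e = F (cut \<gamma> R e) e"
      unfolding \<gamma>_def by (rule wfrec[OF \<open>wf R\<close>])
    also have "\<dots> = F \<gamma> e"
      by (simp add: F_def cut_apply cong: if_cong)
    finally show ?thesis .
  qed
  define G where "G = Hahn (\<lambda>e. if e \<in> W then \<gamma> e else 0)"
  have G: "coef G e = (if e \<in> W then \<gamma> e else 0)" for e
    unfolding G_def by (subst coef_Hahn[OF well_ordered_support_mono[OF wW]]) (auto split: if_splits)
  have step: "e \<in> W" if "a \<in> W" "coef (P a) e \<noteq> 0" for a e
  proof -
    obtain t n where "t \<in> support T" "n \<in> N" "a = t + n"
      using \<open>a \<in> W\<close> unfolding W_def by (meson set_plus_elim)
    moreover from this have "n + (e - a) \<in> N"
      using coef_P_support[OF that(2)] N_add by blast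
    ultimately show ?thesis
      using set_plus_intro[of t "support T" "n + (e - a)" N] by (simp add: W_def)
  qed
  have "subst G = T"
  proof (rule hahn_eqI)
    fix e
    show "coef (subst G) e = coef T e"
    proof (cases "e \<in> W")
      case False
      have "coef G a * coef (P a) e = 0" for a
        using step False by (auto simp: G)
      moreover have "coef T e = 0"
        using set_plus_intro[of e "support T" 0 N] zero_in_N False by (auto simp: W_def support_def)
      ultimately show ?thesis
        by (simp only: coef_subst Sum_any.neutral)
    next
      case True
      let ?g = "\<lambda>a. if (a, e) \<in> R then \<gamma> a * coef (P a) e else 0"
      have *: "(\<lambda>a. coef G a * coef (P a) e) = ?g(e := \<gamma> e * coef (P e) e)"
      proof
        fix a
        show "coef G a * coef (P a) e = (?g(e := \<gamma> e * coef (P e) e)) a"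
          using True coef_P_support[of a e] N_nonneg[of "e - a"] by (auto simp: G R_def)
      qed
      have "finite {a. ?g a \<noteq> 0}"
        by (rule finite_subset[OF _ finite_subst[OF wW, of e]]) (auto simp: R_def)
      then have "coef (subst G) e = \<gamma> e * coef (P e) e + Sum_any ?g"
        unfolding coef_subst * by (rule Sum_any.update) (simp add: R_def)
      also have "\<gamma> e * coef (P e) e = coef T e - Sum_any ?g"
        by (subst \<gamma>) (simp add: F_def coef_P_leading)
      finally show ?thesis
        by simp
    qed
  qed
  then show thesis
    by (rule that)
qed

end

section \<open>Powers of a series of degree one\<close>

text \<open>The powers of c y (1 + u), where \<open>\<kappa> a\<close> stands for the chosen
  determination of c^a. The laws of a homomorphism replace the explicit formula with modulus and
  argument.\<close>

locale power_determination =
  fixes \<kappa> :: "real \<Rightarrow> complex" and u :: hahn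
  assumes \<kappa>_add: "\<kappa> (a + b) = \<kappa> a * \<kappa> b"
    and \<kappa>_zero: "\<kappa> 0 = 1"
    and positive_u: "positive u"
begin

definition pow :: "real \<Rightarrow> hahn" where
  "pow a = hahn_monom (\<kappa> a) a * binomial_series u (of_real a)"

lemma \<kappa>_nonzero: "\<kappa> a \<noteq> 0"
  using \<kappa>_add[of a "-a"] by (auto simp: \<kappa>_zero)

sublocale power_family pow "additive_closure (support u)"
proof
  show "well_ordered (additive_closure (support u))"
    by (rule well_ordered_closure_support[OF positive_u])
  show "0 \<in> additive_closure (support u)"
    by (rule zero_in_additive_closure)
  show "x + y \<in> additive_closure (support u)"
    if "x \<in> additive_closure (support u)" "y \<in> additive_closure (support u)" for x y
    using that by (rule additive_closure_add)
  show "0 \<le> x" if "x \<in> additive_closure (support u)" for x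
    using additive_closure_nonneg positive_u that by (auto simp: positive_def)
  show "e - a \<in> additive_closure (support u)" if "coef (pow a) e \<noteq> 0" for a e
    using that support_binomial_series[OF positive_u] by (auto simp: pow_def coef_hahn_monom_times support_def)
  show "coef (pow a) a \<noteq> 0" for a
    by (simp add: pow_def coef_hahn_monom_times coef_binomial_series_0 positive_u \<kappa>_nonzero)
  show "pow (a + b) = pow a * pow b" for a b
    by (simp add: pow_def \<kappa>_add binomial_series_add positive_u hahn_monom_mult[symmetric] algebra_simps)
  show "pow 0 = 1"
    using binomial_series_of_nat[OF positive_u, of 0]
    by (simp add: pow_def \<kappa>_zero one_eq_hahn_monom[symmetric])
qed

lemma pow_of_nat: "pow (of_nat n) = pow 1 ^ n"
  by (induction n) (auto simp: P_add P_zero)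

text \<open>Writing g = (1 / \<kappa> 1) y (1 + v), the equation
  \<open>subst g = hahn_monom 1 1\<close> becomes (1 + u)(1 + \<open>subst v\<close>) = 1. Hence the
  binomial series of u and of \<open>subst v\<close> are reciprocal for every exponent c, and the
  matching power of g is sent to the pure monomial of exponent c.\<close>

lemma inverse_power:
  assumes g: "subst g = hahn_monom 1 1"
  shows "coef g 1 = 1 / \<kappa> 1"
    and "positive (hahn_monom (\<kappa> 1) (-1) * g - 1)"
    and "subst (hahn_monom (1 / \<kappa> c) c * binomial_series (hahn_monom (\<kappa> 1) (-1) * g - 1) (of_real c)) = hahn_monom 1 c"
proof -
  have "g \<noteq> 0"
    using g coef_hahn_monom[of 1 1 1] by (auto simp: coef_subst dest!: arg_cong[of _ _ "\<lambda>g. coef g 1"])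
  then obtain a where a: "coef g a \<noteq> 0" "\<And>b. b \<in> support g \<Longrightarrow> a \<le> b" "coef (subst g) a \<noteq> 0"
    using least_exponent by blast
  \<comment> \<open>The least exponent of g survives in \<open>subst g\<close>, whose only exponent
    is 1.\<close>
  then have "a = 1"
    by (simp add: g coef_hahn_monom split: if_splits)
  with a have least: "\<And>b. b \<in> support g \<Longrightarrow> 1 \<le> b"
    by simp
  have "coef g 1 * \<kappa> 1 = 1"
    using coef_subst_least[of g 1, OF least]
    by (simp add: g coef_hahn_monom pow_def coef_hahn_monom_times coef_binomial_series_0 positive_u)
  then show g1: "coef g 1 = 1 / \<kappa> 1"
    by (simp add: field_simps \<kappa>_nonzero)
  define v where "v = hahn_monom (\<kappa> 1) (-1) * g - 1"
  show v: "positive (hahn_monom (\<kappa> 1) (-1) * g - 1)"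
    unfolding positive_def
  proof
    fix x assume x: "x \<in> support (hahn_monom (\<kappa> 1) (-1) * g - 1)"
    have "x \<noteq> 0"
      using x g1 \<kappa>_nonzero[of 1] by (auto simp: support_def coef_hahn_monom_times coef_one)
    with x have "x + 1 \<in> support g"
      by (auto simp: support_def coef_hahn_monom_times coef_one)
    with least \<open>x \<noteq> 0\<close> show "x \<in> {0<..}"
      by force
  qed
  have g_eq: "g = hahn_monom (1 / \<kappa> 1) 1 * (1 + v)"
    by (simp add: v_def mult.assoc[symmetric] hahn_monom_mult \<kappa>_nonzero one_eq_hahn_monom[symmetric])
  have pow1: "pow 1 = hahn_monom (\<kappa> 1) 1 * (1 + u)"
    using binomial_series_of_nat[OF positive_u, of 1] by (simp add: pow_def)
  have "hahn_monom 1 1 = hahn_monom (1 / \<kappa> 1) 0 * (pow 1 * subst (1 + v))"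
    using g by (simp add: g_eq subst_hahn_monom_times)
  also have "\<dots> = (hahn_monom (1 / \<kappa> 1) 0 * hahn_monom (\<kappa> 1) 1) * ((1 + u) * (1 + subst v))"
    by (simp add: pow1 subst_add subst_one mult.assoc)
  also have "hahn_monom (1 / \<kappa> 1) 0 * hahn_monom (\<kappa> 1) 1 = hahn_monom 1 1"
    by (simp add: hahn_monom_mult \<kappa>_nonzero)
  \<comment> \<open>Multiplying by the monomial of exponent -1 cancels the factor of exponent
    1.\<close>
  finally have "hahn_monom 1 (-1) * hahn_monom 1 1 = hahn_monom 1 (-1) * (hahn_monom 1 1 * ((1 + u) * (1 + subst v)))"
    by (rule arg_cong)
  then have "(1 + u) * (1 + subst v) = 1"
    by (simp add: mult.assoc[symmetric] hahn_monom_mult one_eq_hahn_monom[symmetric])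
  then have uv: "u + subst v + u * subst v = 0"
    by (simp add: algebra_simps)
  have pos: "positive v" "positive (subst v)"
    using v positive_subst by (auto simp: v_def)
  have "subst (hahn_monom (1 / \<kappa> c) c * binomial_series v (of_real c)) =
        (hahn_monom (1 / \<kappa> c) 0 * hahn_monom (\<kappa> c) c) * (binomial_series u (of_real c) * binomial_series (subst v) (of_real c))"
    by (simp add: subst_hahn_monom_times pow_def subst_binomial_series pos mult.assoc)
  also have "\<dots> = hahn_monom 1 c"
    by (simp add: binomial_series_mult positive_u pos uv binomial_series_zero hahn_monom_mult \<kappa>_nonzero)
  finally show "subst (hahn_monom (1 / \<kappa> c) c * binomial_series (hahn_monom (\<kappa> 1) (-1) * g - 1) (of_real c)) = hahn_monom 1 c"
    unfolding v_def .
qed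

end

section \<open>Determinations of powers as elements of the ring\<close>

definition det_factor :: "int \<Rightarrow> complex \<Rightarrow> real \<Rightarrow> complex" where
  "det_factor n c b = of_real (norm c powr b) * exp (\<i> * of_real (b * (Arg c + 2 * pi * of_int n)))"

lemma det_factor_add: "det_factor n c (a + b) = det_factor n c a * det_factor n c b"
  by (simp add: det_factor_def powr_add ring_distribs exp_add)

lemma det_factor_zero: "c \<noteq> 0 \<Longrightarrow> det_factor n c 0 = 1"
  by (simp add: det_factor_def)

lemma det_factor_one: "det_factor n c 1 = c"
proof -
  have "det_factor n c 1 = (of_real (norm c) * exp (\<i> * of_real (Arg c))) * exp (of_int n * (of_real pi * (\<i> * 2)))"
    by (simp add: det_factor_def exp_add[symmetric] algebra_simps)
  also have "exp (of_int n * (of_real pi * (\<i> * 2))) = 1"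
    using exp_integer_2pi[of "of_int n"] by (simp add: mult.commute mult.left_commute)
  also have "of_real (norm c) * exp (\<i> * of_real (Arg c)) = c"
    using Arg_eq[of c] by (cases "c = 0") auto
  finally show ?thesis
    by simp
qed

text \<open>The number \<open>inverse_determination n f\<close> makes the argument used for 1 / f 1
  the exact negative of the one used for f 1, so that all real powers are reciprocal.\<close>

lemma det_factor_inverse:
  assumes "f 1 \<noteq> 0"
  shows "det_factor (inverse_determination n f) (1 / f 1) b = 1 / det_factor n (f 1) b"
proof -
  have "det_factor (inverse_determination n f) (1 / f 1) b =
        of_real (norm (inverse (f 1)) powr b) * exp (\<i> * of_real (b * (- (Arg (f 1) + 2 * pi * of_int n))))"
    unfolding det_factor_def inverse_eq_divide[symmetric] Arg_inverse_determination[where f = f, OF assms] ..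
  also have "norm (inverse (f 1)) powr b = inverse (norm (f 1) powr b)"
    by (simp add: norm_inverse powr_def ln_inverse exp_minus assms)
  also have "exp (\<i> * of_real (b * (- (Arg (f 1) + 2 * pi * of_int n)))) =
             inverse (exp (\<i> * of_real (b * (Arg (f 1) + 2 * pi * of_int n))))"
    unfolding exp_minus[symmetric] by (rule arg_cong[of _ _ exp]) (simp add: algebra_simps)
  finally show ?thesis
    by (simp add: det_factor_def inverse_eq_divide)
qed

text \<open>The ring element belonging to \<open>unit_tail f\<close>. Building it from ring
  operations makes its support well-ordered automatically.\<close>

definition tail :: "art_series \<Rightarrow> hahn" where
  "tail f = hahn_monom (1 / f 1) (-1) * Hahn f - 1"

lemma coef_tail:
  assumes "well_ordered {x. f x \<noteq> 0}"
  shows "coef (tail f) = unit_tail f"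
  by (rule ext) (simp add: tail_def coef_hahn_monom_times coef_Hahn assms unit_tail_def coef_one art_one_def)

lemma coef_power: "coef (u ^ k) = (art_mult (coef u) ^^ k) art_one"
  by (induction k) (simp_all add: one_hahn.rep_eq times_hahn.rep_eq)

lemma det_power_eq:
  assumes "well_ordered {x. f x \<noteq> 0}" "positive (tail f)"
  shows "det_power n f b =
         coef (hahn_monom (det_factor n (f 1) b) b * binomial_series (tail f) (of_real b))"
  by (rule ext)
     (simp add: det_power_def coef_hahn_monom_times coef_binomial_series assms coef_power coef_tail
        det_factor_def)

text \<open>This lets the discrete case be treated inside the locale \<open>delta\<close>, which
  works with real exponents.\<close>

lemma delta_operator_UNIV: "delta_operator J f \<Longrightarrow> delta_operator UNIV f"
  by (auto simp: delta_operator_def artinian_def)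

locale delta =
  fixes f :: art_series and n :: int
  assumes delta: "delta_operator UNIV f"
begin

lemma well_ordered_f: "well_ordered {x. f x \<noteq> 0}"
  and f1: "f 1 \<noteq> 0"
  and f_degree: "f b \<noteq> 0 \<Longrightarrow> 1 \<le> b"
  using delta by (auto simp: delta_operator_def artinian_def has_art_degree_def)

lemma positive_tail: "positive (tail f)"
  unfolding positive_def
proof
  fix x assume "x \<in> support (tail f)"
  then have x: "unit_tail f x \<noteq> 0"
    by (simp add: support_def coef_tail well_ordered_f)
  then have "x \<noteq> 0"
    using f1 by (auto simp: unit_tail_def art_one_def)
  with x f_degree[of "x + 1"] show "x \<in> {0<..}"
    by (force simp: unit_tail_def art_one_def)
qed

sublocale power_determination "det_factor n (f 1)" "tail f"
  by unfold_locales (simp_all add: det_factor_add det_factor_zero f1 positive_tail)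

lemma det_power_f: "det_power n f b = coef (pow b)"
  unfolding pow_def by (rule det_power_eq[OF well_ordered_f positive_tail])

lemma pow_one: "pow 1 = Hahn f"
proof -
  have "pow 1 = hahn_monom (f 1) 1 * (1 + tail f)"
    using binomial_series_of_nat[OF positive_tail, of 1] by (simp add: pow_def det_factor_one)
  then show ?thesis
    by (simp add: tail_def mult.assoc[symmetric] hahn_monom_mult f1 one_eq_hahn_monom[symmetric])
qed

lemma det_subst_eq: "det_subst n f (coef g) = coef (subst g)"
  by (rule ext) (simp add: det_subst_def coef_subst det_power_f)

text \<open>The definite description is resolved by g itself; uniqueness is the injectivity of
  \<open>subst\<close>.\<close>

lemma det_inverse_eq:
  assumes g: "subst g = hahn_monom 1 1"
  shows "det_inverse n f = coef g"
  unfolding det_inverse_def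
proof (rule the_equality)
  have m: "(\<lambda>e. of_bool (e = 1)) = coef (hahn_monom 1 1)"
    by (auto simp: coef_hahn_monom)
  show "artinian UNIV (coef g) \<and> det_subst n f (coef g) = (\<lambda>e. of_bool (e = 1))"
    using coef[of g] by (simp add: artinian_def det_subst_eq g m)
  fix h assume h: "artinian UNIV h \<and> det_subst n f h = (\<lambda>e. of_bool (e = 1))"
  then have "coef (Hahn h) = h"
    by (intro coef_Hahn) (simp add: artinian_def)
  with h have "coef (subst (Hahn h)) = coef (subst g)"
    by (simp add: det_subst_eq[symmetric] g m)
  then have "Hahn h = g"
    using subst_inject by (simp add: coef_inject)
  with \<open>coef (Hahn h) = h\<close> show "h = coef g"
    by simp
qed

text \<open>The factor 1 / \<kappa> c of \<open>inverse_power\<close> is, by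
  \<open>det_factor_inverse\<close>, the determination numbered
  \<open>inverse_determination n f\<close> of the leading coefficient 1 / f 1 raised to c. So the
  preimages of the monomials are the powers formed in \<open>log_exp_det\<close>.\<close>

lemma det_inverse_powers:
  obtains G where "\<And>c. subst (G c) = hahn_monom 1 c"
    and "\<And>c. det_power (inverse_determination n f) (det_inverse n f) c = coef (G c)"
proof -
  obtain g where g: "subst g = hahn_monom 1 1"
    by (rule subst_surj)
  note inv = inverse_power[OF g, unfolded det_factor_one]
  have tail_g: "tail (coef g) = hahn_monom (f 1) (-1) * g - 1"
    by (simp add: tail_def inv(1) coef_inverse)
  have "det_power (inverse_determination n f) (coef g) c =
        coef (hahn_monom (det_factor (inverse_determination n f) (coef g 1) c) c *
          binomial_series (tail (coef g)) (of_real c))" for c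
    by (rule det_power_eq) (use coef[of g] inv(2) in \<open>simp_all add: tail_g\<close>)
  then show ?thesis
    using inv by (intro that[of "\<lambda>c. hahn_monom (1 / det_factor n (f 1) c) c *
          binomial_series (hahn_monom (f 1) (-1) * g - 1) (of_real c)"])
      (simp_all add: det_inverse_eq[OF g] tail_g det_factor_inverse f1)
qed

end

section \<open>Laurent series\<close>

text \<open>Embedding Laurent series into the ring allows \<open>subst\<close> to act on the usual
  compositional inverse and its integer powers.\<close>

definition fls_hahn :: "complex fls \<Rightarrow> hahn" where
  "fls_hahn F = Hahn (\<lambda>x. if x \<in> \<int> then fls_nth F \<lfloor>x\<rfloor> else 0)"

lemma coef_fls_hahn: "coef (fls_hahn F) x = (if x \<in> \<int> then fls_nth F \<lfloor>x\<rfloor> else 0)"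
proof -
  have "well_ordered (range (\<lambda>n::nat. real_of_int (fls_subdegree F) + real n))"
    by (simp add: wfp_on_image)
  then have "well_ordered {x::real. (if x \<in> \<int> then fls_nth F \<lfloor>x\<rfloor> else 0) \<noteq> 0}"
  proof (rule well_ordered_support_mono)
    fix x :: real assume "(if x \<in> \<int> then fls_nth F \<lfloor>x\<rfloor> else 0) \<noteq> 0"
    then obtain i where i: "x = of_int i" "fls_nth F i \<noteq> 0"
      by (auto elim!: Ints_cases split: if_splits)
    then have "fls_subdegree F \<le> i"
      by (intro fls_subdegree_leI)
    with i show "x \<in> range (\<lambda>n::nat. real_of_int (fls_subdegree F) + real n)"
      by (intro image_eqI[of _ _ "nat (i - fls_subdegree F)"]) auto
  qed
  then show ?thesis
    unfolding fls_hahn_def by (subst coef_Hahn) auto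
qed

lemma coef_fls_hahn_of_int [simp]: "coef (fls_hahn F) (of_int i) = fls_nth F i"
  by (simp add: coef_fls_hahn)

lemma fls_hahn_times: "fls_hahn (F * G) = fls_hahn F * fls_hahn G"
proof (rule hahn_eqI)
  fix e
  show "coef (fls_hahn (F * G)) e = coef (fls_hahn F * fls_hahn G) e"
  proof (cases "e \<in> \<int>")
    case False
    have "coef (fls_hahn F) a * coef (fls_hahn G) (e - a) = 0" for a
      using False Ints_add[of a "e - a"] by (auto simp: coef_fls_hahn)
    then show ?thesis
      using False by (simp only: coef_times Sum_any.neutral) (simp add: coef_fls_hahn)
  next
    case True
    then obtain j where j: "e = of_int j"
      by (auto elim: Ints_cases)
    \<comment> \<open>This range contains all indices of nonzero products and is the one in
      \<open>fls_times_nth(2)\<close>.\<close>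
    let ?I = "{fls_subdegree F..j - fls_subdegree G}"
    have "coef (fls_hahn F * fls_hahn G) e =
          (\<Sum>a\<in>real_of_int ` ?I. coef (fls_hahn F) a * coef (fls_hahn G) (e - a))"
      unfolding coef_times
    proof (rule Sum_any.expand_superset)
      show "{a. coef (fls_hahn F) a * coef (fls_hahn G) (e - a) \<noteq> 0} \<subseteq> real_of_int ` ?I"
      proof
        fix a assume "a \<in> {a. coef (fls_hahn F) a * coef (fls_hahn G) (e - a) \<noteq> 0}"
        then have a: "coef (fls_hahn F) a \<noteq> 0" "coef (fls_hahn G) (e - a) \<noteq> 0"
          by auto
        then obtain i where i: "a = of_int i"
          by (auto simp: coef_fls_hahn elim!: Ints_cases split: if_splits)
        with a have "fls_nth F i \<noteq> 0" "fls_nth G (j - i) \<noteq> 0"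
          by (simp_all add: j flip: of_int_diff)
        then have "fls_subdegree F \<le> i" "fls_subdegree G \<le> j - i"
          by (auto intro: fls_subdegree_leI)
        with i show "a \<in> real_of_int ` ?I"
          by auto
      qed
    qed auto
    also have "\<dots> = (\<Sum>i\<in>?I. fls_nth F i * fls_nth G (j - i))"
      by (subst sum.reindex) (auto simp: j inj_on_def simp flip: of_int_diff)
    also have "\<dots> = fls_nth (F * G) j"
      by (simp add: fls_times_nth(2))
    finally show ?thesis
      by (simp add: j)
  qed
qed

lemma fls_hahn_one: "fls_hahn 1 = 1"
  by (rule hahn_eqI) (auto simp: coef_fls_hahn coef_one elim!: Ints_cases)

lemma fls_hahn_power: "fls_hahn (F ^ m) = fls_hahn F ^ m"
  by (induction m) (auto simp: fls_hahn_one fls_hahn_times)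

lemma coef_fls_hahn_fps:
  "coef (fls_hahn (fps_to_fls F)) (of_nat k) = fps_nth F k"
  "x \<notin> \<nat> \<Longrightarrow> coef (fls_hahn (fps_to_fls F)) x = 0"
proof -
  show "coef (fls_hahn (fps_to_fls F)) (of_nat k) = fps_nth F k"
    using coef_fls_hahn_of_int[of "fps_to_fls F" "int k"] by simp
  show "coef (fls_hahn (fps_to_fls F)) x = 0" if "x \<notin> \<nat>"
    using that by (auto simp: coef_fls_hahn Nats_altdef2)
qed

lemma hahn_monom_power: "hahn_monom 1 a ^ m = hahn_monom 1 (of_nat m * a)"
  by (induction m) (auto simp: one_eq_hahn_monom hahn_monom_mult algebra_simps)

section \<open>The usual compositional inverse in the discrete case\<close>

context delta
begin

text \<open>For natural m, \<open>pow (of_nat m)\<close> is the ordinary power of F. So the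
  coefficients of the substituted series are those of the composition \<open>fps_inv F oo F\<close>,
  which is \<open>fps_X\<close>.\<close>

lemma subst_fps_inv:
  assumes f: "{b. f b \<noteq> 0} \<subseteq> \<int>"
  defines "F \<equiv> Abs_fps (\<lambda>k. f (of_nat k))"
  shows "subst (fls_hahn (fps_to_fls (fps_inv F))) = hahn_monom 1 1"
proof (rule hahn_eqI)
  fix e
  have F01: "fps_nth F 0 = 0" "fps_nth F 1 \<noteq> 0"
    using f1 f_degree[of 0] by (auto simp: F_def)
  have "Hahn f = fls_hahn (fps_to_fls F)"
  proof (rule hahn_eqI)
    fix x
    show "coef (Hahn f) x = coef (fls_hahn (fps_to_fls F)) x"
    proof (cases "x \<in> \<nat>")
      case True
      then show ?thesis
        by (auto elim!: Nats_cases simp: coef_fls_hahn_fps coef_Hahn well_ordered_f F_def)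
    next
      case False
      then have "f x = 0"
        using f f_degree[of x] by (force simp: Nats_altdef2)
      with False show ?thesis
        by (simp add: coef_fls_hahn_fps coef_Hahn well_ordered_f)
    qed
  qed
  then have pow: "pow (of_nat m) = fls_hahn (fps_to_fls (F ^ m))" for m
    by (simp add: pow_of_nat pow_one fls_hahn_power fps_to_fls_power)
  let ?g = "fls_hahn (fps_to_fls (fps_inv F))"
  show "coef (subst ?g) e = coef (hahn_monom 1 1) e"
  proof (cases "e \<in> \<nat>")
    case False
    have "coef ?g a * coef (pow a) e = 0" for a
      using False by (cases "a \<in> \<nat>") (auto elim!: Nats_cases simp: coef_fls_hahn_fps pow)
    moreover have "e \<noteq> 1"
      using False by auto
    ultimately show ?thesis
      by (simp only: coef_subst Sum_any.neutral) (simp add: coef_hahn_monom)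
  next
    case True
    then obtain k where k: "e = of_nat k"
      by (auto elim: Nats_cases)
    have "coef (subst ?g) e = (\<Sum>a\<in>real ` {0..k}. coef ?g a * coef (pow a) e)"
      unfolding coef_subst
    proof (rule Sum_any.expand_superset)
      show "{a. coef ?g a * coef (pow a) e \<noteq> 0} \<subseteq> real ` {0..k}"
      proof
        fix a assume a: "a \<in> {a. coef ?g a * coef (pow a) e \<noteq> 0}"
        then have "a \<in> \<nat>"
          using coef_fls_hahn_fps(2)[of a "fps_inv F"] by auto
        then obtain m where m: "a = of_nat m"
          by (auto elim: Nats_cases)
        with a have "fps_nth (F ^ m) k \<noteq> 0"
          by (simp add: pow k coef_fls_hahn_fps)
        then have "m \<le> k"
          using startsby_zero_power_prefix[OF F01(1), of m] by (meson not_le)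
        with m show "a \<in> real ` {0..k}"
          by auto
      qed
    qed auto
    also have "\<dots> = (\<Sum>m=0..k. fps_nth (fps_inv F) m * fps_nth (F ^ m) k)"
      by (subst sum.reindex) (auto simp: inj_on_def pow k coef_fls_hahn_fps)
    also have "\<dots> = fps_nth (fps_inv F oo F) k"
      by (simp add: fps_compose_nth)
    also have "fps_inv F oo F = fps_X"
      using F01 by (rule fps_inv)
    finally show ?thesis
      by (auto simp: k coef_hahn_monom)
  qed
qed

text \<open>Natural powers follow from multiplicativity. A negative power is the inverse of a
  natural one, and so is its image, which is then isolated by a monomial of opposite
  exponent.\<close>

lemma subst_fls_power_int:
  assumes g: "subst (fls_hahn g) = hahn_monom 1 1"
  shows "subst (fls_hahn (g powi i)) = hahn_monom 1 (of_int i)"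
proof -
  have pos: "subst (fls_hahn (g ^ m)) = hahn_monom 1 (of_nat m)" for m
    by (simp add: fls_hahn_power subst_power g hahn_monom_power)
  have "g \<noteq> 0"
  proof
    assume "g = 0"
    then have "coef (subst (fls_hahn g)) 1 = 0"
      by (simp add: coef_subst coef_fls_hahn cong: if_cong)
    then show False
      by (simp add: g coef_hahn_monom)
  qed
  show ?thesis
  proof (cases i rule: int_cases2)
    case (nonneg m)
    then show ?thesis
      by (simp add: pos)
  next
    case (nonpos m)
    have "subst (fls_hahn (g powi i)) * subst (fls_hahn (g ^ m)) = subst (fls_hahn (g powi i * g ^ m))"
      by (simp add: subst_times fls_hahn_times)
    also have "g powi i * g ^ m = 1"
      using \<open>g \<noteq> 0\<close> by (simp add: nonpos power_int_minus)
    finally have "subst (fls_hahn (g powi i)) * hahn_monom 1 (of_nat m) * hahn_monom 1 (- of_nat m) =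
                  hahn_monom 1 (- of_nat m)"
      by (simp add: pos fls_hahn_one subst_one)
    then show ?thesis
      by (simp add: nonpos mult.assoc hahn_monom_mult one_eq_hahn_monom[symmetric])
  qed
qed

end

section \<open>Harmonic logarithms\<close>

text \<open>If a is not a negative integer, a + 1 is not a pole of the gamma function, and
  \<open>Gamma\<close> has the value 0 only at the poles.\<close>

lemma roman_factorial_nonzero: "roman_factorial a \<noteq> 0"
proof (cases "a \<in> \<int> \<and> a < 0")
  case False
  have "a + 1 \<notin> \<int>\<^sub>\<le>\<^sub>0"
  proof
    assume "a + 1 \<in> \<int>\<^sub>\<le>\<^sub>0"
    then obtain k where "k \<le> 0" "a + 1 = of_int k"
      by (auto elim: nonpos_Ints_cases)
    then have "a = of_int (k - 1)" "a < 0"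
      by auto
    with False show False
      by (metis Ints_of_int)
  qed
  with False show ?thesis
    by (simp add: roman_factorial_def Gamma_eq_zero_iff)
qed (auto simp: roman_factorial_def)

lemma roman_factorial_zero [simp]: "roman_factorial 0 = 1"
  by (simp add: roman_factorial_def)

lemma deriv_monom_fst:
  assumes "deriv_monom m' m \<noteq> 0"
  shows "fst m = fst m' - 1"
proof (rule ccontr)
  assume *: "fst m \<noteq> fst m' - 1"
  then have "log_monom (fst m' - 1, \<gamma>) m = 0" for \<gamma>
    by (auto simp: log_monom_def)
  with assms show False
    by (simp add: deriv_monom_def case_prod_beta)
qed

text \<open>Differentiation lowers the exponent of x by one and the factor x restores it.\<close>

lemma xD_fst:
  assumes "\<And>m. s m \<noteq> 0 \<Longrightarrow> fst m = 0" "xD s m \<noteq> 0"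
  shows "fst m = 0"
proof -
  obtain b \<beta> where m: "m = (b, \<beta>)"
    by (cases m)
  have "Sum_any (\<lambda>m'. s m' * deriv_monom m' (b - 1, \<beta>)) \<noteq> 0"
    using assms(2) by (simp add: m xD_def x_times_def log_deriv_def)
  then obtain m' where "s m' * deriv_monom m' (b - 1, \<beta>) \<noteq> 0"
    by (rule Sum_any.not_neutral_obtains_not_neutral)
  then show ?thesis
    using assms(1)[of m'] deriv_monom_fst[of m' "(b - 1, \<beta>)"] by (simp add: m)
qed

lemma xD_power_fst: "(xD ^^ k) (log_monom (0, \<alpha>)) m \<noteq> 0 \<Longrightarrow> fst m = 0"
proof (induction k arbitrary: m)
  case (Suc k)
  show ?case
    by (rule xD_fst[of "(xD ^^ k) (log_monom (0, \<alpha>))"]) (use Suc in auto)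
qed (auto simp: log_monom_def)

lemma harmonic_log_eq:
  "harmonic_log a \<alpha> (b, \<beta>) = of_real (roman_factorial a) *
     Sum_any (\<lambda>k. fps_nth (harmonic_coeffs a) k * (xD ^^ k) (log_monom (0, \<alpha>)) (b - a, \<beta>))"
  by (simp add: harmonic_log_def x_times_def)

lemma harmonic_log_fst:
  assumes "harmonic_log a \<alpha> m \<noteq> 0"
  shows "fst m = a"
proof -
  obtain b \<beta> where m: "m = (b, \<beta>)"
    by (cases m)
  have "Sum_any (\<lambda>k. fps_nth (harmonic_coeffs a) k * (xD ^^ k) (log_monom (0, \<alpha>)) (b - a, \<beta>)) \<noteq> 0"
    using assms by (auto simp: m harmonic_log_eq)
  then obtain k where "(xD ^^ k) (log_monom (0, \<alpha>)) (b - a, \<beta>) \<noteq> 0"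
    by (rule Sum_any.not_neutral_obtains_not_neutral) auto
  from xD_power_fst[OF this] show ?thesis
    by (simp add: m)
qed

lemma harmonic_log_eq_0: "a \<noteq> fst m \<Longrightarrow> harmonic_log a \<alpha> m = 0"
  using harmonic_log_fst[of a \<alpha> m] by auto

lemma harmonic_sum_eq: "harmonic_sum \<alpha> c m = c (fst m) * harmonic_log (fst m) \<alpha> m"
  unfolding harmonic_sum_def by (rule Sum_any_single) (simp add: harmonic_log_eq_0)

text \<open>
  The vector \<open>\<alpha> \<noteq> 0\<close> to which regularity is applied. For it the expansion of the harmonic logarithm
  has only two terms, those of \<open>log x\<close> and \<open>1\<close>.
\<close>

definition log_vector :: "nat \<Rightarrow>\<^sub>0 real" where
  "log_vector = Poly_Mapping.single 0 1"

lemma log_vector_nonzero: "log_vector \<noteq> 0"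
  by (simp add: log_vector_def)

lemma xD_log: "xD (log_monom (0, log_vector)) = log_monom (0, 0)"
proof
  fix m :: log_monomial
  obtain b \<beta> where m: "m = (b, \<beta>)"
    by (cases m)
  have "xD (log_monom (0, log_vector)) m =
        Sum_any (\<lambda>m'. log_monom (0, log_vector) m' * deriv_monom m' (b - 1, \<beta>))"
    by (simp add: m xD_def x_times_def log_deriv_def)
  also have "\<dots> = deriv_monom (0, log_vector) (b - 1, \<beta>)"
    by (subst Sum_any_single[of "(0, log_vector)"]) (auto simp: log_monom_def)
  also have "\<dots> = log_monom (0, 0) m"
    by (simp add: m deriv_monom_def log_monom_def log_vector_def)
  finally show "xD (log_monom (0, log_vector)) m = log_monom (0, 0) m" .
qed

lemma xD_one: "xD (log_monom (0, 0)) = (\<lambda>_. 0)"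
proof
  fix m :: log_monomial
  obtain b \<beta> where m: "m = (b, \<beta>)"
    by (cases m)
  have "xD (log_monom (0, 0)) m = Sum_any (\<lambda>m'. log_monom (0, 0) m' * deriv_monom m' (b - 1, \<beta>))"
    by (simp add: m xD_def x_times_def log_deriv_def)
  also have "\<dots> = deriv_monom (0, 0) (b - 1, \<beta>)"
    by (subst Sum_any_single[of "(0, 0)"]) (auto simp: log_monom_def)
  also have "\<dots> = 0"
    by (simp add: deriv_monom_def)
  finally show "xD (log_monom (0, 0)) m = 0" .
qed

lemma xD_zero: "xD (\<lambda>_. 0) = (\<lambda>_. 0)"
  by (auto simp: xD_def x_times_def log_deriv_def)

lemma xD_power_log:
  "(xD ^^ k) (log_monom (0, log_vector)) =
     (if k = 0 then log_monom (0, log_vector) else if k = 1 then log_monom (0, 0) else (\<lambda>_. 0))"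
proof (cases k)
  case (Suc j)
  have "(xD ^^ Suc j) (log_monom (0, log_vector)) = (if j = 0 then log_monom (0, 0) else (\<lambda>_. 0))" for j
    by (induction j) (auto simp: xD_log xD_one xD_zero)
  then show ?thesis
    by (simp add: Suc)
qed simp

lemma harmonic_log_log_vector:
  "harmonic_log a log_vector (a, log_vector) = of_real (roman_factorial a) * fps_nth (harmonic_coeffs a) 0"
  "harmonic_log a log_vector (a, 0) = of_real (roman_factorial a) * fps_nth (harmonic_coeffs a) 1"
proof -
  note [simp] = log_vector_nonzero log_vector_nonzero[symmetric]
  show "harmonic_log a log_vector (a, log_vector) = of_real (roman_factorial a) * fps_nth (harmonic_coeffs a) 0"
    unfolding harmonic_log_eq xD_power_log
    by (subst Sum_any_single[of 0]) (auto simp: log_monom_def)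
  show "harmonic_log a log_vector (a, 0) = of_real (roman_factorial a) * fps_nth (harmonic_coeffs a) 1"
    unfolding harmonic_log_eq xD_power_log
    by (subst Sum_any_single[of 1]) (auto simp: log_monom_def)
qed

text \<open>At a negative integer the reciprocal of the gamma function has a simple zero.\<close>

lemma harmonic_coeffs_nonzero:
  "fps_nth (harmonic_coeffs a) 0 \<noteq> 0 \<or> fps_nth (harmonic_coeffs a) 1 \<noteq> 0"
proof (cases "complex_of_real a + 1 \<in> \<int>\<^sub>\<le>\<^sub>0")
  case False
  then show ?thesis
    by (simp add: harmonic_coeffs_def fps_expansion_def Gamma_eq_zero_iff)
next
  case True
  then obtain m where m: "complex_of_real a + 1 = - of_nat m"
    by (auto elim: nonpos_Ints_cases')
  \<comment> \<open>\<open>rGamma\<close> is entire and agrees with 1 / \<open>Gamma\<close> also at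
    the poles, where both are 0; so the product rule applies at s = 0.\<close>
  let ?G = "\<lambda>s. Gamma (s + 1) * rGamma (s + (complex_of_real a + 1))"
  have "(\<lambda>s. Gamma (s + 1) / Gamma (s + complex_of_real a + 1)) = ?G"
    by (simp add: rGamma_inverse_Gamma divide_inverse add.assoc)
  moreover have "((\<lambda>s. rGamma (s + (complex_of_real a + 1))) has_field_derivative (-1) ^ m * fact m) (at 0)"
    using has_field_derivative_rGamma_nonpos_int[where ?'a = complex, of m UNIV] DERIV_shift[of rGamma _ 0 "complex_of_real a + 1"]
    by (simp only: m add_0_left)
  moreover have "((\<lambda>s. Gamma (s + 1)) has_field_derivative Digamma (1::complex)) (at 0)"
    using has_field_derivative_Gamma[of "1::complex" UNIV] DERIV_shift[of Gamma _ 0 "1::complex"]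
    by simp
  ultimately have "((\<lambda>s. Gamma (s + 1) / Gamma (s + complex_of_real a + 1)) has_field_derivative
       (Digamma 1 * rGamma (0 + (complex_of_real a + 1)) + (-1) ^ m * fact m * Gamma (0 + 1))) (at 0)"
    using DERIV_mult by fastforce
  moreover have "rGamma (complex_of_real a + 1) = 0"
    using True by (simp add: rGamma_eq_zero_iff)
  ultimately have "deriv (\<lambda>s. Gamma (s + 1) / Gamma (s + complex_of_real a + 1)) 0 = (-1) ^ m * fact m"
    by (intro DERIV_imp_deriv) simp
  then show ?thesis
    by (simp add: harmonic_coeffs_def fps_expansion_def)
qed

text \<open>For each a the harmonic logarithm is nonzero at x^a log x or at x^a, and comparing
  coefficients at that monomial recovers c a. For the zero vector this would fail at negative
  integers a.\<close>

lemma harmonic_sum_inject: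
  assumes "harmonic_sum log_vector c = harmonic_sum log_vector d"
  shows "c = d"
proof
  fix a
  obtain \<beta> where "harmonic_log a log_vector (a, \<beta>) \<noteq> 0"
    using harmonic_coeffs_nonzero[of a] roman_factorial_nonzero[of a] harmonic_log_log_vector[of a]
    by (metis mult_eq_0_iff of_real_eq_0_iff)
  then show "c a = d a"
    using fun_cong[OF assms, of "(a, \<beta>)"] by (simp add: harmonic_sum_eq)
qed

lemma harmonic_coeff_sum:
  assumes "c \<in> harmonic_families J"
  shows "harmonic_coeff J log_vector (harmonic_sum log_vector c) = c"
  unfolding harmonic_coeff_def using assms by (intro some_equality) (auto dest: harmonic_sum_inject)

text \<open>At a monomial m only pairs (a, b) with a - b = \<open>fst m\<close> contribute, so the
  sum over pairs becomes a sum over a.\<close>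

lemma apply_operator_sum:
  assumes q: "q \<in> harmonic_families J" and g: "artinian UNIV g"
  shows "apply_operator J log_vector g (harmonic_sum log_vector q) =
    harmonic_sum log_vector
      (\<lambda>x. Sum_any (\<lambda>a. q a * g (a - x) * of_real (roman_factorial a / roman_factorial x)))"
proof
  fix m
  let ?h = "\<lambda>(a, b). q a * g b * of_real (roman_factorial a / roman_factorial (a - b)) *
        harmonic_log (a - b) log_vector m"
  let ?A = "{a. q a \<noteq> 0 \<and> g (a - fst m) \<noteq> 0}"
  \<comment> \<open>Negation makes the reverse well-ordered exponents of q well-ordered; the
    condition says that b + \<open>fst m\<close> is one of them.\<close>
  have "finite {b\<in>{b. g b \<noteq> 0}. - fst m - b \<in> uminus ` {a. q a \<noteq> 0}}"
    using q g by (intro finite_fibre) (simp_all add: artinian_def harmonic_families_def rev_well_ordered_iff)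
  then have fin: "finite ?A"
    by (rule finite_surj[of _ _ "\<lambda>b. b + fst m"]) (force simp: image_iff)
  have "apply_operator J log_vector g (harmonic_sum log_vector q) m = Sum_any ?h"
    by (simp add: apply_operator_def harmonic_coeff_sum q)
  also have "\<dots> = sum ?h ((\<lambda>a. (a, a - fst m)) ` ?A)"
  proof (rule Sum_any.expand_superset)
    show "{p. ?h p \<noteq> 0} \<subseteq> (\<lambda>a. (a, a - fst m)) ` ?A"
    proof
      fix p assume "p \<in> {p. ?h p \<noteq> 0}"
      then obtain a b where p: "p = (a, b)" "q a \<noteq> 0" "g b \<noteq> 0" "harmonic_log (a - b) log_vector m \<noteq> 0"
        by (cases p) auto
      from harmonic_log_fst[OF p(4)] have "b = a - fst m"
        by simp
      with p show "p \<in> (\<lambda>a. (a, a - fst m)) ` ?A"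
        by auto
    qed
  qed (use fin in simp)
  also have "\<dots> = (\<Sum>a\<in>?A. q a * g (a - fst m) * of_real (roman_factorial a / roman_factorial (fst m)) *
                  harmonic_log (fst m) log_vector m)"
    by (subst sum.reindex) (auto simp: inj_on_def)
  also have "\<dots> = (\<Sum>a\<in>?A. q a * g (a - fst m) * of_real (roman_factorial a / roman_factorial (fst m))) *
                  harmonic_log (fst m) log_vector m"
    by (simp only: sum_distrib_right)
  also have "(\<Sum>a\<in>?A. q a * g (a - fst m) * of_real (roman_factorial a / roman_factorial (fst m))) =
      Sum_any (\<lambda>a. q a * g (a - fst m) * of_real (roman_factorial a / roman_factorial (fst m)))"
    by (rule Sum_any.expand_superset[symmetric, OF fin]) auto
  finally show "apply_operator J log_vector g (harmonic_sum log_vector q) m =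
    harmonic_sum log_vector
      (\<lambda>x. Sum_any (\<lambda>a. q a * g (a - x) * of_real (roman_factorial a / roman_factorial x))) m"
    by (rule trans) (simp only: harmonic_sum_eq)
qed

text \<open>The transformed coefficients form an admissible family, since -x = (a - x) + (-a) lies
  in a sumset of well-ordered sets. Hence the bracket is their value at x = 0, where the Roman
  factorial in the denominator is 1.\<close>

lemma bracket_apply_operator:
  assumes q: "q \<in> harmonic_families J" and g: "artinian J g"
    and J: "\<And>x y. x \<in> J \<Longrightarrow> y \<in> J \<Longrightarrow> x - y \<in> J"
  shows "bracket J log_vector (apply_operator J log_vector g (harmonic_sum log_vector q)) =
         Sum_any (\<lambda>a. q a * g a * of_real (roman_factorial a))"
proof -
  let ?r = "\<lambda>x. Sum_any (\<lambda>a. q a * g (a - x) * of_real (roman_factorial a / roman_factorial x))"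
  have r: "\<exists>a. q a \<noteq> 0 \<and> g (a - x) \<noteq> 0" if "?r x \<noteq> 0" for x
    using Sum_any.not_neutral_obtains_not_neutral[OF that] by (metis mult_eq_0_iff)
  have "?r \<in> harmonic_families J"
    unfolding harmonic_families_def
  proof (intro CollectI conjI subsetI)
    fix x assume "x \<in> {x. ?r x \<noteq> 0}"
    then obtain a where "q a \<noteq> 0" "g (a - x) \<noteq> 0"
      using r by blast
    then have "a \<in> J" "a - x \<in> J"
      using q g by (auto simp: harmonic_families_def artinian_def)
    from J[OF this] show "x \<in> J"
      by simp
  next
    have "well_ordered ({b. g b \<noteq> 0} + uminus ` {a. q a \<noteq> 0})"
      using q g by (intro well_ordered_sumset)
        (simp_all add: harmonic_families_def artinian_def rev_well_ordered_iff)
    then have "well_ordered (uminus ` {x. ?r x \<noteq> 0})"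
    proof (rule wfp_on_subset, intro image_subsetI)
      fix x assume "x \<in> {x. ?r x \<noteq> 0}"
      then obtain a where a: "q a \<noteq> 0" "g (a - x) \<noteq> 0"
        using r by blast
      then have "(a - x) + (- a) \<in> {b. g b \<noteq> 0} + uminus ` {a. q a \<noteq> 0}"
        by (intro set_plus_intro) auto
      then show "- x \<in> {b. g b \<noteq> 0} + uminus ` {a. q a \<noteq> 0}"
        by simp
    qed
    then show "wfp_on {x. ?r x \<noteq> 0} (>)"
      by (simp only: rev_well_ordered_iff)
  qed
  moreover have "artinian UNIV g"
    using g by (simp add: artinian_def)
  ultimately show ?thesis
    by (simp add: bracket_def apply_operator_sum q harmonic_coeff_sum)
qed

section \<open>The coefficients of the associated sequence\<close>

context delta
begin

text \<open>Allowing any J that contains 1 and is closed under subtraction, and any preimages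
  \<open>G c\<close> of the monomials, serves both interpretations at once.\<close>

lemma associated_sequence_eq:
  assumes J: "1 \<in> J" "\<And>x y. x \<in> J \<Longrightarrow> y \<in> J \<Longrightarrow> x - y \<in> J"
    and f: "{b. f b \<noteq> 0} \<subseteq> J"
    and p: "associated_sequence J n f p"
    and G: "\<And>c. c \<in> J \<Longrightarrow> subst (G c) = hahn_monom 1 c" "\<And>c. c \<in> J \<Longrightarrow> support (G c) \<subseteq> J"
    and a: "a \<in> J" and \<beta>: "\<beta> \<in> index_vectors J"
  shows "p a \<beta> m / of_real (roman_factorial a) = (if fst m \<in> J
           then harmonic_log (fst m) \<beta> m / of_real (roman_factorial (fst m)) * coef (G (fst m)) a else 0)"
proof -
  have J0: "0 \<in> J"
    using J(2)[OF J(1) J(1)] by simp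
  have J_add: "x + y \<in> J" if "x \<in> J" "y \<in> J" for x y
    using J(2)[OF that(1) J(2)[OF J0 that(2)]] by simp
  have lv: "log_vector \<in> index_vectors J - {0}"
    using J0 J(1) log_vector_nonzero
    by (auto simp: index_vectors_def log_vector_def lookup_single when_def simp del: single_one)
  have "p a log_vector \<in> harmonic_space J log_vector"
    using p a lv by (auto simp: associated_sequence_def graded_sequence_def)
  then obtain q where q: "q \<in> harmonic_families J" "p a log_vector = harmonic_sum log_vector q"
    by (auto simp: harmonic_space_def)
  have "harmonic_sum \<beta> (harmonic_coeff J log_vector (p a log_vector)) = p a \<beta>"
    using p a lv \<beta> by (auto simp: associated_sequence_def graded_sequence_def regular_family_def)
  then have p_eq: "p a \<beta> m = q (fst m) * harmonic_log (fst m) \<beta> m"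
    by (simp add: q harmonic_coeff_sum harmonic_sum_eq[symmetric])
  have tail_J: "support (tail f) \<subseteq> J"
  proof
    fix x assume "x \<in> support (tail f)"
    then have "unit_tail f x \<noteq> 0"
      by (simp add: support_def coef_tail well_ordered_f)
    then have "x + 1 \<in> J \<or> x = 0"
      using f by (auto simp: unit_tail_def art_one_def split: if_splits)
    then show "x \<in> J"
      using J0 J(2)[of "x + 1" 1] J(1) by auto
  qed
  have pow_J: "artinian J (coef (pow b))" if "b \<in> J" for b
    unfolding artinian_def
  proof
    show "{e. coef (pow b) e \<noteq> 0} \<subseteq> J"
    proof
      fix e assume "e \<in> {e. coef (pow b) e \<noteq> 0}"
      then have "e - b \<in> additive_closure (support (tail f))"
        by (simp add: coef_P_support)
      then have "e - b \<in> J"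
        using additive_closure_subset[OF tail_J J0 J_add] by blast
      from J_add[OF this that] show "e \<in> J"
        by simp
    qed
    show "well_ordered {e. coef (pow b) e \<noteq> 0}"
      using coef[of "pow b"] by simp
  qed
  define r where "r = (\<lambda>c. q c * of_real (roman_factorial c) / of_real (roman_factorial a))"
  have r0: "r c = 0 \<longleftrightarrow> q c = 0" for c
    by (simp add: r_def roman_factorial_nonzero)
  have orth: "Sum_any (\<lambda>c. r c * coef (pow b) c) = (if a = b then 1 else 0)" if b: "b \<in> J" for b
  proof -
    have "Sum_any (\<lambda>c. r c * coef (pow b) c) =
          Sum_any (\<lambda>c. q c * coef (pow b) c * of_real (roman_factorial c) * (1 / of_real (roman_factorial a)))"
      by (simp add: r_def mult_ac)
    also have "\<dots> = Sum_any (\<lambda>c. q c * coef (pow b) c * of_real (roman_factorial c)) *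
          (1 / of_real (roman_factorial a))"
      by (rule Sum_any_mult_right)
    also have "Sum_any (\<lambda>c. q c * coef (pow b) c * of_real (roman_factorial c)) =
               bracket J log_vector (apply_operator J log_vector (det_power n f b) (p a log_vector))"
      by (simp add: det_power_f q bracket_apply_operator[OF q(1) pow_J[OF b] J(2)])
    also have "\<dots> = (if a = b then of_real (roman_factorial a) else 0)"
      using p a b lv by (auto simp: associated_sequence_def)
    finally show ?thesis
      by (simp add: roman_factorial_nonzero)
  qed
  \<comment> \<open>The relations \<open>orth\<close> are weighted with the coefficients of
    \<open>G x\<close> and summed over b. After the exchange of sums the weight of
    \<open>r c\<close> is a coefficient of \<open>subst (G x)\<close>, so only \<open>r x\<close>
    remains.\<close>
  have coef_G: "coef (G x) a = r x" if x: "x \<in> J" for x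
  proof -
    have "coef (G x) a = Sum_any (\<lambda>b. coef (G x) b * (if a = b then 1 else 0))"
      by (subst Sum_any_single[of a]) auto
    also have "\<dots> = Sum_any (\<lambda>b. coef (G x) b * Sum_any (\<lambda>c. r c * coef (pow b) c))"
    proof (rule Sum_any.cong)
      show "coef (G x) b * (if a = b then 1 else 0) = coef (G x) b * Sum_any (\<lambda>c. r c * coef (pow b) c)" for b
        using orth[of b] G(2)[OF x] by (cases "b \<in> J") (auto simp: support_def)
    qed
    also have "\<dots> = Sum_any (\<lambda>b. Sum_any (\<lambda>c. coef (G x) b * (r c * coef (pow b) c)))"
      by (simp only: Sum_any_mult_left)
    also have "\<dots> = Sum_any (\<lambda>c. Sum_any (\<lambda>b. coef (G x) b * (r c * coef (pow b) c)))"
    proof (rule Sum_any_swap)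
      have "well_ordered (uminus ` {c. q c \<noteq> 0})"
        using q(1) by (simp add: harmonic_families_def rev_well_ordered_iff)
      \<comment> \<open>With e = 0 in \<open>finite_fibre_three'\<close>, the third set consists of
        the negated exponents of q, which is well-ordered.\<close>
      then have "finite {(c, b). b \<in> support (G x) \<and> c - b \<in> additive_closure (support (tail f)) \<and>
                   0 - c \<in> uminus ` {c. q c \<noteq> 0}}"
        by (intro finite_fibre_three' well_ordered_support well_ordered_N)
      then have "finite (prod.swap ` {(c, b). b \<in> support (G x) \<and>
                   c - b \<in> additive_closure (support (tail f)) \<and> 0 - c \<in> uminus ` {c. q c \<noteq> 0}})"
        (is "finite (_ ` ?S)")
        by (rule finite_imageI)
      then show "finite {(b, c). coef (G x) b * (r c * coef (pow b) c) \<noteq> 0}"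
      proof (rule finite_subset[rotated], intro subsetI)
        fix z assume "z \<in> {(b, c). coef (G x) b * (r c * coef (pow b) c) \<noteq> 0}"
        then obtain b c where z: "z = (b, c)" "coef (G x) b \<noteq> 0" "q c \<noteq> 0" "coef (pow b) c \<noteq> 0"
          by (auto simp: r0)
        then have "(c, b) \<in> ?S"
          using coef_P_support[of b c] by (simp add: support_def[of "G x"])
        with z show "z \<in> prod.swap ` ?S"
          by (intro rev_image_eqI[of "(c, b)"]) simp_all
      qed
    qed
    also have "\<dots> = Sum_any (\<lambda>c. r c * coef (subst (G x)) c)"
      by (simp only: mult.left_commute[of _ "r _"] Sum_any_mult_left coef_subst)
    also have "\<dots> = r x"
      by (subst Sum_any_single[of x]) (auto simp: G(1)[OF x] coef_hahn_monom)
    finally show ?thesis .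
  qed
  show ?thesis
  proof (cases "fst m \<in> J")
    case True
    then show ?thesis
      by (simp add: p_eq coef_G r_def roman_factorial_nonzero)
  next
    case False
    then have "q (fst m) = 0"
      using q(1) by (auto simp: harmonic_families_def)
    with False show ?thesis
      by (simp add: p_eq)
  qed
qed

end

section \<open>Comparison with the logarithmic exponential in both interpretations\<close>

theorem theorem4p2:
  fixes f :: art_series
    and p :: "real \<Rightarrow> (nat \<Rightarrow>\<^sub>0 real) \<Rightarrow> log_series"
    and n :: int
  shows "(delta_operator \<int> f \<and> associated_sequence \<int> n f p \<longrightarrow>
            (\<forall>\<alpha>\<in>index_vectors \<int>.
               (\<lambda>k::int. \<lambda>m. p (of_int k) \<alpha> m / of_real (roman_factorial (of_int k))) =
               log_exp \<alpha> (fps_to_fls (fps_inv (Abs_fps (\<lambda>k. f (of_nat k)))))))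
       \<and> (delta_operator UNIV f \<and> associated_sequence UNIV n f p \<longrightarrow>
            (\<forall>\<alpha>.
               (\<lambda>a. \<lambda>m. p a \<alpha> m / of_real (roman_factorial a)) =
               log_exp_det (inverse_determination n f) \<alpha> (det_inverse n f)))"
proof (intro conjI impI ballI allI)
  fix \<alpha> assume "delta_operator \<int> f \<and> associated_sequence \<int> n f p" and \<alpha>: "\<alpha> \<in> index_vectors \<int>"
  then have f: "delta_operator \<int> f" and p: "associated_sequence \<int> n f p"
    by auto
  interpret delta f n
    by unfold_locales (rule delta_operator_UNIV[OF f])
  have fZ: "{b. f b \<noteq> 0} \<subseteq> \<int>"
    using f by (simp add: delta_operator_def artinian_def)
  define g where "g = fps_to_fls (fps_inv (Abs_fps (\<lambda>k. f (of_nat k))))"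
  have g: "subst (fls_hahn g) = hahn_monom 1 1"
    unfolding g_def by (rule subst_fps_inv[OF fZ])
  \<comment> \<open>For integer c the usual power of g is the preimage of the monomial of exponent
    c; the floor converts the real index into an exponent for \<open>powi\<close>.\<close>
  have eq: "p (of_int k) \<alpha> m / of_real (roman_factorial (of_int k)) = (if fst m \<in> \<int>
      then harmonic_log (fst m) \<alpha> m / of_real (roman_factorial (fst m)) *
        coef (fls_hahn (g powi \<lfloor>fst m\<rfloor>)) (of_int k) else 0)" for k :: int and m
  proof (rule associated_sequence_eq[OF _ _ fZ p _ _ _ \<alpha>])
    show "subst (fls_hahn (g powi \<lfloor>c\<rfloor>)) = hahn_monom 1 c" if "c \<in> \<int>" for c
      using that by (auto simp: subst_fls_power_int[OF g] elim!: Ints_cases)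
    show "support (fls_hahn (g powi \<lfloor>c\<rfloor>)) \<subseteq> \<int>" for c
      by (auto simp: support_def coef_fls_hahn split: if_splits)
  qed auto
  \<comment> \<open>At a monomial m only the summand with index \<open>fst m\<close> survives in
    \<open>log_exp\<close>; if \<open>fst m\<close> is not an integer, both sides are 0.\<close>
  have "p (of_int k) \<alpha> m / of_real (roman_factorial (of_int k)) = log_exp \<alpha> g k m" for k :: int and m
  proof (cases "fst m \<in> \<int>")
    case True
    then obtain i where i: "fst m = of_int i"
      by (auto elim: Ints_cases)
    have "log_exp \<alpha> g k m =
          harmonic_log (of_int i) \<alpha> m / of_real (roman_factorial (of_int i)) * fls_nth (g powi i) k"
      unfolding log_exp_def by (rule Sum_any_single) (simp add: harmonic_log_eq_0 i)
    then show ?thesis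
      by (simp add: eq i)
  next
    case False
    then have "harmonic_log (of_int i) \<alpha> m = 0" for i
      using harmonic_log_eq_0[of "of_int i" m \<alpha>] by (metis Ints_of_int)
    with False show ?thesis
      by (simp add: eq log_exp_def)
  qed
  then show "(\<lambda>k::int. \<lambda>m. p (of_int k) \<alpha> m / of_real (roman_factorial (of_int k))) =
        log_exp \<alpha> (fps_to_fls (fps_inv (Abs_fps (\<lambda>k. f (of_nat k)))))"
    by (simp add: g_def fun_eq_iff)
next
  fix \<alpha> assume "delta_operator UNIV f \<and> associated_sequence UNIV n f p"
  then have f: "delta_operator UNIV f" and p: "associated_sequence UNIV n f p"
    by auto
  interpret delta f n
    by unfold_locales (rule f)
  obtain G where G: "\<And>c. subst (G c) = hahn_monom 1 c"
    "\<And>c. det_power (inverse_determination n f) (det_inverse n f) c = coef (G c)"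
    using det_inverse_powers by blast
  have "p a \<alpha> m / of_real (roman_factorial a) =
        log_exp_det (inverse_determination n f) \<alpha> (det_inverse n f) a m" for a m
  proof -
    have "log_exp_det (inverse_determination n f) \<alpha> (det_inverse n f) a m =
          harmonic_log (fst m) \<alpha> m / of_real (roman_factorial (fst m)) * coef (G (fst m)) a"
      unfolding log_exp_det_def G(2) by (rule Sum_any_single) (simp add: harmonic_log_eq_0)
    moreover have "p a \<alpha> m / of_real (roman_factorial a) = (if fst m \<in> UNIV
        then harmonic_log (fst m) \<alpha> m / of_real (roman_factorial (fst m)) * coef (G (fst m)) a else 0)"
      by (rule associated_sequence_eq[OF _ _ _ p]) (simp_all add: G(1) index_vectors_def)
    ultimately show ?thesis
      by simp
  qed
  then show "(\<lambda>a. \<lambda>m. p a \<alpha> m / of_real (roman_factorial a)) =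
        log_exp_det (inverse_determination n f) \<alpha> (det_inverse n f)"
    by (simp add: fun_eq_iff)
qed

end
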